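(* Assume $\mathscr{D}(A^* )=\mathscr{D}(A)$ and $A+A^*=0$. Assume also $C\in\mathcal{L}(\mathcal{X},\mathcal{Y})$ and that, for some $\delta>0$, $\int_0^T\|Ce^{At}x\|^2dt\ge\delta\|x\|^2$ for all $x\in\mathcal{X}$. Choose the observer gains $\kappa_j>0$ so that $\sum_{j=1}^\infty\kappa_j=\infty$ and $\sum_{j=1}^\infty\kappa_j^2<\infty$. Let $z_j^\pm$ be given by the back and forth nudging iteration with feedback $\kappa_jC^*$ (defined in the context), started from an arbitrary $z_1^+(0)\in\mathcal{X}$. Then, as $j\to\infty$, the initial state estimate $z_j^+(0)$ converges strongly (in the norm of $\mathcal{X}$) to the minimizer over $x\in\mathcal{X}$ of the cost function $$J(x)=\frac12\int_0^T\|y(s)-Cz[x](s)\|^2ds,$$ where $z[x]$ is the solution of $\dot z[x]=Az[x]+f$, $z[x](0)=x$.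
   Context: $\mathcal{X}$ and $\mathcal{Y}$ are separable Hilbert spaces, $T>0$, and $\mathcal{L}(\mathcal{X},\mathcal{Y})$ is the space of bounded linear operators. $A$, with domain $\mathscr{D}(A)\subset\mathcal{X}$, generates a strongly continuous dissipative (contraction) semigroup $e^{At}$ on $\mathcal{X}$. The measured output $y$ on $[0,T]$ comes from $\dot z=Az+f+\eta$, $z(0)=z_0$, $y=Cz+\nu$, where the load $f\in L^1(0,T;\mathcal{X})$ is known and $\eta,\nu$ are unknown noise terms. Apart from this, one only assumes that the load and noise terms are smooth enough that $y\in L^2(0,T;\mathcal{Y})$. All differential equations are understood in the mild sense. Back and forth nudging iteration with feedback $\kappa_jC^*$, for $j=1,2,\dots$ and $t\in[0,T]$: Forward observer: $\dot z_j^+(t)=Az_j^+(t)+f(t)+\kappa_jC^*\big(y(t)-Cz_j^+(t)\big)$, with $z_j^+(0)=z_{j-1}^-(T)$ for $j\ge2$ and $z_1^+(0)\in\mathcal{X}$ arbitrary. Backward observer: $\dot z_j^-(t)=-Az_j^-(t)-f(T-t)+\kappa_jC^*\big(y(T-t)-Cz_j^-(t)\big)$, with $z_j^-(0)=z_j^+(T)$. *)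

theory Defs
  imports "HOL-Analysis.Analysis"
begin

text \<open>
  Hilbert spaces are types of sort \<open>{real_inner, banach, second_countable_topology}\<close>, where second
  countability is separability. A complex Hilbert space is covered through the real inner product
  \<open>Re \<langle>x, y\<rangle>\<close>, which gives the same norm, the same adjoints of complex-linear operators and the
  same semigroups. An unbounded operator is a pair of a domain \<open>D\<close> and a function \<open>A\<close>; the values
  of \<open>A\<close> outside \<open>D\<close> are irrelevant.
\<close>

definition C0_semigroup :: "(real \<Rightarrow> 'a::real_normed_vector \<Rightarrow> 'a) \<Rightarrow> bool" where
  "C0_semigroup S \<longleftrightarrow>
     (\<forall>t\<ge>0. bounded_linear (S t)) \<and>
     (\<forall>x. S 0 x = x) \<and>
     (\<forall>s\<ge>0. \<forall>t\<ge>0. \<forall>x. S (s + t) x = S s (S t x)) \<and>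
     (\<forall>x. ((\<lambda>t. S t x) \<longlongrightarrow> x) (at_right 0))"

definition generates ::
  "'a::real_normed_vector set \<Rightarrow> ('a \<Rightarrow> 'a) \<Rightarrow> (real \<Rightarrow> 'a \<Rightarrow> 'a) \<Rightarrow> bool" where
  "generates D A S \<longleftrightarrow>
     C0_semigroup S \<and>
     D = {x. \<exists>y. ((\<lambda>h. (S h x - x) /\<^sub>R h) \<longlongrightarrow> y) (at_right 0)} \<and>
     (\<forall>x\<in>D. ((\<lambda>h. (S h x - x) /\<^sub>R h) \<longlongrightarrow> A x) (at_right 0))"

text \<open>
  The semigroup \<open>e\<^sup>A\<^sup>t\<close>. A generator determines its semigroup on \<open>t \<ge> 0\<close>, so the choice below
  only affects the (unused) values at negative times.
\<close>

definition exp_semigroup ::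
  "'a::real_normed_vector set \<Rightarrow> ('a \<Rightarrow> 'a) \<Rightarrow> real \<Rightarrow> 'a \<Rightarrow> 'a" where
  "exp_semigroup D A = (SOME S. generates D A S)"

definition generates_contraction_semigroup ::
  "'a::real_normed_vector set \<Rightarrow> ('a \<Rightarrow> 'a) \<Rightarrow> bool" where
  "generates_contraction_semigroup D A \<longleftrightarrow>
     (\<exists>S. generates D A S \<and> (\<forall>t\<ge>0. \<forall>x. norm (S t x) \<le> norm x))"

text \<open>
  Adjoint of an operator with domain. It is single-valued when \<open>D\<close> is dense, as the domain of
  every generator is.
\<close>

definition adj_domain :: "'a::real_inner set \<Rightarrow> ('a \<Rightarrow> 'a) \<Rightarrow> 'a set" where
  "adj_domain D A = {y. \<exists>w. \<forall>x\<in>D. A x \<bullet> y = x \<bullet> w}"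

definition adj_operator :: "'a::real_inner set \<Rightarrow> ('a \<Rightarrow> 'a) \<Rightarrow> 'a \<Rightarrow> 'a" where
  "adj_operator D A y = (THE w. \<forall>x\<in>D. A x \<bullet> y = x \<bullet> w)"

text \<open>The variation of constants formula for \<open>z' = A z + g\<close>, \<open>z(0) = x\<close>.\<close>

definition mild_sol ::
  "'a::{real_inner,banach,second_countable_topology} set \<Rightarrow> ('a \<Rightarrow> 'a) \<Rightarrow> (real \<Rightarrow> 'a)
     \<Rightarrow> 'a \<Rightarrow> real \<Rightarrow> 'a" where
  "mild_sol D A g x t =
     exp_semigroup D A t x + (LINT s:{0..t}|lebesgue. exp_semigroup D A (t - s) (g s))"

text \<open>
  The right-hand side \<open>g\<close> may itself depend on \<open>z\<close> (as in an observer), which turns the variation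
  of constants formula into an integral equation for \<open>z\<close>.
\<close>

definition is_mild_solution ::
  "'a::{real_inner,banach,second_countable_topology} set \<Rightarrow> ('a \<Rightarrow> 'a) \<Rightarrow> real \<Rightarrow> (real \<Rightarrow> 'a)
     \<Rightarrow> 'a \<Rightarrow> (real \<Rightarrow> 'a) \<Rightarrow> bool" where
  "is_mild_solution D A T g x z \<longleftrightarrow>
     set_integrable lebesgue {0..T} g \<and> (\<forall>t\<in>{0..T}. z t = mild_sol D A g x t)"

definition L2_on ::
  "real set \<Rightarrow> (real \<Rightarrow> 'b::{real_inner,banach,second_countable_topology}) \<Rightarrow> bool" where
  "L2_on I y \<longleftrightarrow>
     set_borel_measurable lebesgue I y \<and> set_integrable lebesgue I (\<lambda>t. (norm (y t))\<^sup>2)"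

definition cost ::
  "'a::{real_inner,banach,second_countable_topology} set \<Rightarrow> ('a \<Rightarrow> 'a) \<Rightarrow>
   ('a \<Rightarrow> 'b::{real_inner,banach,second_countable_topology}) \<Rightarrow>
   real \<Rightarrow> (real \<Rightarrow> 'a) \<Rightarrow> (real \<Rightarrow> 'b) \<Rightarrow> 'a \<Rightarrow> real" where
  "cost D A C T f y x =
     1 / 2 * (LINT s:{0..T}|lebesgue. (norm (y s - C (mild_sol D A f x s)))\<^sup>2)"

end

theory Submission
  imports Defs
begin

text \<open>
  Skew-adjointness makes \<open>e\<^sup>A\<^sup>t\<close> a unitary group \<open>G\<close>, and the backward observer is driven by
  \<open>G (- t)\<close> (\<open>Stone_group\<close>). Both observers can therefore be compared with a reference trajectory
  \<open>z[X]\<close> after pulling the difference back to time zero: \<open>e(t) = G(-t) (z\<^sub>j\<^sup>+(t) - z[X](t))\<close> on the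
  way forward, and the same expression read backwards in time on the way back. The generator and the
  load cancel, and with gain \<open>\<kappa>\<close> what remains is the equation with bounded coefficients
  \<open>e' = \<kappa> (\<psi>(t) - P(t) e)\<close>, where \<open>P(t) = G(-t) C\<^sup>* C G(t)\<close> and
  \<open>\<psi>(t) = G(-t) C\<^sup>* (y(t) - C z[X](t))\<close>.

  The integral of \<open>P\<close> over \<open>[0,T]\<close> is the observability Gramian, which the observability inequality
  makes coercive. Hence the cost is a coercive quadratic function, and it is minimized exactly at the
  point \<open>X\<close> that solves the normal equation (\<open>normal_equation\<close>, \<open>unique_minimizer\<close>). The normal
  equation says that \<open>\<psi>\<close> has integral zero over \<open>[0,T]\<close>. So the part of the measurement that no
  trajectory can explain is averaged out over each half cycle: as \<open>e\<close> moves only by \<open>O(\<kappa>)\<close>, one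
  half cycle maps \<open>e\<close> to \<open>e - \<kappa> \<integral>P e + O(\<kappa>\<^sup>2)\<close>, with norm at most
  \<open>(1 - \<delta> \<kappa> + O(\<kappa>\<^sup>2)) \<parallel>e\<parallel> + O(\<kappa>\<^sup>2)\<close> (\<open>half_cycle_estimate\<close>). Since the gains have a divergent
  sum and a convergent sum of squares, the contractions multiply up to zero while the perturbations
  remain summable, and the error at time zero vanishes in the limit
  (\<open>contraction_recursion_tendsto_0\<close>).
\<close>

section \<open>Strongly continuous semigroups and their generators\<close>

text \<open>
  The sets on which the family is bounded by \<open>k\<close> are closed and cover the space, so by Baire one of
  them contains a ball; linearity spreads the bound on that ball to all vectors.
\<close>

lemma uniform_boundedness:
  fixes F :: "nat \<Rightarrow> 'a::banach \<Rightarrow> 'b::real_normed_vector"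
  assumes lin: "\<And>n. bounded_linear (F n)"
    and bdd: "\<And>x. Bseq (\<lambda>n. F n x)"
  obtains K where "\<And>n x. norm (F n x) \<le> K * norm x"
proof -
  define E where "E k = {x. \<forall>n. norm (F n x) \<le> real k}" for k :: nat
  have E_closed: "closed (E k)" for k
  proof -
    have "E k = (\<Inter>n. {x. norm (F n x) \<le> real k})" by (auto simp: E_def)
    moreover have "closed {x. norm (F n x) \<le> real k}" for n
      by (intro closed_Collect_le continuous_on_norm continuous_on_const
          bounded_linear.continuous_on[OF lin] continuous_on_id)
    ultimately show ?thesis by auto
  qed
  have E_cover: "(\<Union>k. E k) = UNIV"
  proof -
    have "\<exists>k. x \<in> E k" for x
    proof -
      obtain K where "\<And>n. norm (F n x) \<le> K" using bdd[of x] by (auto simp: Bseq_def)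
      moreover obtain k :: nat where "K \<le> real k" using real_arch_simple by blast
      ultimately show ?thesis unfolding E_def by (auto intro: order_trans)
    qed
    then show ?thesis by auto
  qed
  have "\<exists>k. interior (E k) \<noteq> {}"
  proof (rule ccontr)
    assume "\<not> ?thesis"
    then have "(euclidean::'a topology) interior_of \<Union>(range E) = {}"
      using E_closed completely_metrizable_space_euclidean
      by (intro Baire_category_alt) auto
    then show False using E_cover by simp
  qed
  then obtain k a r where r: "r > 0" and ball: "cball a r \<subseteq> E k"
    by (metis ex_in_conv mem_interior_cball)
  have bound: "norm (F n x) \<le> (2 * real k / r) * norm x" for n x
  proof (cases "x = 0")
    case True
    then show ?thesis by (simp add: linear_0[OF bounded_linear.linear[OF lin]])
  next
    case False
    define u where "u = (r / norm x) *\<^sub>R x"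
    interpret Fn: bounded_linear "F n" by (rule lin)
    have "norm u = r" using False r by (simp add: u_def)
    then have "a + u \<in> E k" "a \<in> E k" using ball r by (auto simp: dist_norm)
    then have "norm (F n (a + u)) \<le> k" "norm (F n a) \<le> k" by (auto simp: E_def)
    moreover have "F n u = F n (a + u) - F n a" by (simp add: Fn.add)
    ultimately have "norm (F n u) \<le> 2 * k" using norm_triangle_ineq4[of "F n (a + u)" "F n a"] by simp
    moreover have "norm (F n u) = (r / norm x) * norm (F n x)"
      using r by (simp add: u_def Fn.scaleR)
    ultimately show ?thesis using False r by (simp add: field_simps)
  qed
  show ?thesis by (rule that[OF bound])
qed

text \<open>
  Strong continuity is only assumed from the right at \<open>0\<close>, so boundedness on \<open>[0,\<tau>]\<close> is not a
  compactness fact. If \<open>S t\<close> were unbounded near \<open>0\<close>, times \<open>t\<^sub>n \<longlongrightarrow> 0\<close> with large operator norm would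
  contradict uniform boundedness, as \<open>S t\<^sub>n x \<longlongrightarrow> x\<close> for each \<open>x\<close>. The semigroup law extends the bound
  to longer times.
\<close>

lemma C0_semigroup_locally_bounded:
  fixes S :: "real \<Rightarrow> 'a::banach \<Rightarrow> 'a"
  assumes S: "C0_semigroup S"
  obtains M where "M \<ge> 1" "\<And>t x. 0 \<le> t \<Longrightarrow> t \<le> \<tau> \<Longrightarrow> norm (S t x) \<le> M * norm x"
proof -
  have lin: "bounded_linear (S t)" if "t \<ge> 0" for t using S that by (auto simp: C0_semigroup_def)
  have S0: "S 0 x = x" for x using S by (auto simp: C0_semigroup_def)
  have add: "S (s + t) x = S s (S t x)" if "s \<ge> 0" "t \<ge> 0" for s t x
    using S that by (auto simp: C0_semigroup_def)
  have cont0: "((\<lambda>t. S t x) \<longlongrightarrow> x) (at_right 0)" for x using S by (auto simp: C0_semigroup_def)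
  have "\<exists>N::nat. \<forall>t\<in>{0..1 / (real N + 1)}. \<forall>x. norm (S t x) \<le> (real N + 1) * norm x"
  proof (rule ccontr)
    assume "\<not> ?thesis"
    then have "\<forall>n::nat. \<exists>t x. t \<in> {0..1 / (real n + 1)} \<and> norm (S t x) > (real n + 1) * norm x"
      by (force simp: not_le)
    then obtain t x where t: "\<And>n::nat. t n \<in> {0..1 / (real n + 1)}"
      and big: "\<And>n::nat. norm (S (t n) (x n)) > (real n + 1) * norm (x n)"
      by metis
    have tpos: "t n > 0" for n
    proof (rule ccontr)
      assume "\<not> t n > 0"
      then have "t n = 0" using t[of n] by simp
      then have "norm (x n) > (real n + 1) * norm (x n)" using big[of n] by (simp add: S0)
      then show False using mult_right_mono[of 1 "real n + 1" "norm (x n)"] by simp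
    qed
    have "(\<lambda>n::nat. 1 / (real n + 1)) \<longlonglongrightarrow> 0"
      using LIMSEQ_inverse_real_of_nat by (simp add: inverse_eq_divide add.commute)
    then have "t \<longlonglongrightarrow> 0"
      by (rule tendsto_sandwich[OF _ _ tendsto_const, rotated 2]) (use t in auto)
    then have "filterlim t (at_right 0) sequentially"
      using tpos by (auto simp: filterlim_at less_imp_neq[symmetric])
    then have "(\<lambda>n. S (t n) v) \<longlonglongrightarrow> v" for v
      using cont0[of v] by (rule filterlim_compose[rotated])
    then have "Bseq (\<lambda>n. S (t n) v)" for v
      using convergentI convergent_imp_Bseq by blast
    then obtain K where K: "\<And>n v. norm (S (t n) v) \<le> K * norm v"
      using uniform_boundedness[of "\<lambda>n. S (t n)"] lin tpos by (meson less_imp_le)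
    obtain n :: nat where n: "K \<le> real n" using real_arch_simple by blast
    have "norm (x n) \<noteq> 0"
      using big[of n] tpos[of n] linear_0[OF bounded_linear.linear[OF lin[of "t n"]]] by auto
    moreover have "(real n + 1) * norm (x n) < K * norm (x n)" using big[of n] K[of n "x n"] by linarith
    ultimately have "real n + 1 < K" using norm_ge_zero[of "x n"] by (simp add: mult_less_cancel_right)
    with n show False by simp
  qed
  then obtain N :: nat where N: "\<And>t x. t \<in> {0..1 / (real N + 1)} \<Longrightarrow> norm (S t x) \<le> (real N + 1) * norm x"
    by blast
  define \<delta> M where "\<delta> = 1 / (real N + 1)" and "M = real N + 1"
  have \<delta>: "\<delta> > 0" and M: "M \<ge> 1" and MB: "\<And>t x. t \<in> {0..\<delta>} \<Longrightarrow> norm (S t x) \<le> M * norm x"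
    using N by (auto simp: \<delta>_def M_def)
  have iter: "norm (S t x) \<le> M ^ Suc n * norm x" if "0 \<le> t" "t \<le> real (Suc n) * \<delta>" for n t x
    using that
  proof (induction n arbitrary: t)
    case 0
    then show ?case using MB[of t x] by simp
  next
    case (Suc n)
    define s where "s = max 0 (t - \<delta>)"
    have s: "0 \<le> s" "s \<le> real (Suc n) * \<delta>" "t - s \<in> {0..\<delta>}" "0 \<le> t - s"
      using Suc.prems \<delta> by (auto simp: s_def max_def algebra_simps)
    have "S t x = S (t - s) (S s x)" using add[of "t - s" s x] s by simp
    then have "norm (S t x) \<le> M * norm (S s x)" using MB[OF s(3), of "S s x"] by simp
    also have "\<dots> \<le> M * (M ^ Suc n * norm x)" using Suc.IH[OF s(1,2)] M by (intro mult_left_mono) auto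
    finally show ?case by (simp add: mult.assoc)
  qed
  obtain n :: nat where "\<tau> / \<delta> \<le> real n" using real_arch_simple by blast
  then have n: "\<tau> \<le> real (Suc n) * \<delta>" using \<delta> by (simp add: field_simps) 
  show ?thesis
  proof (rule that)
    show "M ^ Suc n \<ge> 1" using M one_le_power by blast
    show "norm (S t x) \<le> M ^ Suc n * norm x" if "0 \<le> t" "t \<le> \<tau>" for t x
      using iter[of t n x] that n by linarith
  qed
qed

text \<open>
  For \<open>u \<le> v\<close> one has \<open>S v x - S u x = S u (S (v - u) x - x)\<close>, so the local bound turns right
  continuity at \<open>0\<close> into continuity from both sides at every time.
\<close>

lemma C0_semigroup_continuous_on:
  fixes S :: "real \<Rightarrow> 'a::banach \<Rightarrow> 'a"
  assumes S: "C0_semigroup S"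
  shows "continuous_on {0..} (\<lambda>t. S t x)"
  unfolding continuous_on_iff
proof (intro ballI allI impI)
  fix t e :: real assume t: "t \<in> {0..}" and e: "e > 0"
  have lin: "bounded_linear (S t)" if "t \<ge> 0" for t using S that by (auto simp: C0_semigroup_def)
  have S0: "S 0 x = x" for x using S by (auto simp: C0_semigroup_def)
  have add: "S (s + t) x = S s (S t x)" if "s \<ge> 0" "t \<ge> 0" for s t x
    using S that by (auto simp: C0_semigroup_def)
  obtain M where M: "M \<ge> 1" and MB: "\<And>s x. 0 \<le> s \<Longrightarrow> s \<le> t + 1 \<Longrightarrow> norm (S s x) \<le> M * norm x"
    using C0_semigroup_locally_bounded[OF S] by blast
  have "((\<lambda>t. S t x) \<longlongrightarrow> x) (at_right 0)" using S by (auto simp: C0_semigroup_def)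
  then have "\<forall>\<^sub>F h in at_right 0. dist (S h x) x < e / M"
    using e M by (auto simp: tendsto_iff)
  then obtain d where d: "d > 0" and dB: "\<And>h. 0 < h \<Longrightarrow> h < d \<Longrightarrow> dist (S h x) x < e / M"
    by (auto simp: eventually_at_right_field)
  have close: "norm (S v x - S u x) < e" if "0 \<le> u" "u \<le> v" "v \<le> t + 1" "v - u < d" for u v
  proof -
    have "dist (S (v - u) x) x < e / M"
      using dB[of "v - u"] that e M by (cases "v = u") (auto simp: S0)
    moreover have "S v x - S u x = S u (S (v - u) x - x)"
      using add[of u "v - u" x] that by (simp add: linear_diff[OF bounded_linear.linear[OF lin]])
    then have "norm (S v x - S u x) \<le> M * norm (S (v - u) x - x)"
      using MB[of u] that by simp
    ultimately show ?thesis using M by (simp add: dist_norm field_simps)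
  qed
  show "\<exists>d>0. \<forall>x'\<in>{0..}. dist x' t < d \<longrightarrow> dist (S x' x) (S t x) < e"
  proof (intro exI[of _ "min d 1"] conjI ballI impI)
    show "min d 1 > 0" using d by simp
    fix u :: real assume u: "u \<in> {0..}" "dist u t < min d 1"
    show "dist (S u x) (S t x) < e"
      using close[of u t] close[of t u] u t
      by (cases "u \<le> t") (auto simp: dist_norm norm_minus_commute)
  qed
qed

lemma generator_invariant:
  assumes gen: "generates D A S" and x: "x \<in> D" and t: "t \<ge> 0"
  shows "S t x \<in> D" "A (S t x) = S t (A x)"
proof -
  have C0: "C0_semigroup S" using gen by (simp add: generates_def)
  have lin: "bounded_linear (S t)" using C0 t by (auto simp: C0_semigroup_def)
  have lim: "((\<lambda>h. (S h (S t x) - S t x) /\<^sub>R h) \<longlongrightarrow> S t (A x)) (at_right 0)"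
  proof -
    have "((\<lambda>h. (S h x - x) /\<^sub>R h) \<longlongrightarrow> A x) (at_right 0)" using gen x by (simp add: generates_def)
    then have "((\<lambda>h. S t ((S h x - x) /\<^sub>R h)) \<longlongrightarrow> S t (A x)) (at_right 0)"
      by (rule bounded_linear.tendsto[OF lin])
    moreover have "\<forall>\<^sub>F h in at_right 0. S t ((S h x - x) /\<^sub>R h) = (S h (S t x) - S t x) /\<^sub>R h"
      unfolding eventually_at_right_field
    proof (intro exI[of _ 1] conjI allI impI)
      fix h :: real assume h: "0 < h" "h < 1"
      have "S (h + t) x = S h (S t x)" "S (t + h) x = S t (S h x)"
        using C0 t h by (auto simp: C0_semigroup_def)
      then show "S t ((S h x - x) /\<^sub>R h) = (S h (S t x) - S t x) /\<^sub>R h"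
        using linear_diff[OF bounded_linear.linear[OF lin]] linear_scale[OF bounded_linear.linear[OF lin]]
        by (simp add: add.commute)
    qed simp
    ultimately show ?thesis by (rule Lim_transform_eventually)
  qed
  show D: "S t x \<in> D" using gen lim by (auto simp: generates_def)
  have "((\<lambda>h. (S h (S t x) - S t x) /\<^sub>R h) \<longlongrightarrow> A (S t x)) (at_right 0)"
    using gen D by (auto simp: generates_def)
  then show "A (S t x) = S t (A x)"
    using lim by (rule tendsto_unique[rotated]) simp
qed

lemma has_vector_derivative_iff_quotient:
  fixes f :: "real \<Rightarrow> 'a::real_normed_vector"
  shows "(f has_vector_derivative f') (at t within S)
    \<longleftrightarrow> ((\<lambda>u. (f u - f t) /\<^sub>R (u - t)) \<longlongrightarrow> f') (at t within S)"
proof -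
  have "norm (f u - f t - (u - t) *\<^sub>R f') / norm (u - t) = norm ((f u - f t) /\<^sub>R (u - t) - f')"
    if "u \<noteq> t" for u
  proof -
    have "f u - f t - (u - t) *\<^sub>R f' = (u - t) *\<^sub>R ((f u - f t) /\<^sub>R (u - t) - f')"
      using that by (simp add: scaleR_diff_right)
    then show ?thesis using that by simp
  qed
  then have "((\<lambda>u. norm (f u - f t - (u - t) *\<^sub>R f') / norm (u - t)) \<longlongrightarrow> 0) (at t within S)
      \<longleftrightarrow> ((\<lambda>u. norm ((f u - f t) /\<^sub>R (u - t) - f')) \<longlongrightarrow> 0) (at t within S)"
    by (intro filterlim_cong refl) (simp add: eventually_at_filter)
  then show ?thesis
    by (simp add: has_vector_derivative_def has_derivative_iff_norm bounded_linear_scaleR_left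
        tendsto_norm_zero_iff LIM_zero_iff)
qed

text \<open>
  With \<open>q h = (S h x - x) / h\<close>, the difference quotient between \<open>u\<close> and \<open>t\<close> is \<open>S (min u t) (q \<bar>u - t\<bar>)\<close>
  on either side of \<open>t\<close>. Hence one limit covers the left and the right derivative, provided that the
  operators \<open>S (min u t)\<close> stay bounded.
\<close>

lemma orbit_has_vector_derivative:
  fixes S :: "real \<Rightarrow> 'a::banach \<Rightarrow> 'a"
  assumes gen: "generates D A S" and x: "x \<in> D" and t: "t \<ge> 0"
  shows "((\<lambda>t. S t x) has_vector_derivative S t (A x)) (at t within {0..})"
proof -
  have C0: "C0_semigroup S" using gen by (simp add: generates_def)
  have lin: "bounded_linear (S t)" if "t \<ge> 0" for t using C0 that by (auto simp: C0_semigroup_def)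
  have add: "S (s + t) x = S s (S t x)" if "s \<ge> 0" "t \<ge> 0" for s t x
    using C0 that by (auto simp: C0_semigroup_def)
  obtain M where M: "M \<ge> 1" and MB: "\<And>s x. 0 \<le> s \<Longrightarrow> s \<le> t + 1 \<Longrightarrow> norm (S s x) \<le> M * norm x"
    using C0_semigroup_locally_bounded[OF C0] by blast
  define q where "q h = (S h x - x) /\<^sub>R h" for h
  have q: "(q \<longlongrightarrow> A x) (at_right 0)" using gen x by (simp add: generates_def q_def[abs_def])
  have absq: "((\<lambda>u. q \<bar>u - t\<bar>) \<longlongrightarrow> A x) (at t within {0..})"
  proof (rule filterlim_compose[OF q])
    show "filterlim (\<lambda>u. \<bar>u - t\<bar>) (at_right 0) (at t within {0..})"
      unfolding filterlim_at
      by (auto intro!: tendsto_eq_intros simp: eventually_at_filter)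
  qed
  have mincont: "((\<lambda>u. S (min u t) (A x)) \<longlongrightarrow> S t (A x)) (at t within {0..})"
  proof -
    have "continuous_on {0..} (\<lambda>u. S (min u t) (A x))"
      by (rule continuous_on_compose2[OF C0_semigroup_continuous_on[OF C0]])
        (use t in \<open>auto intro!: continuous_intros\<close>)
    then show ?thesis using t unfolding continuous_on_def by (auto dest!: bspec[of _ _ t])
  qed
  have "((\<lambda>u. S (min u t) (q \<bar>u - t\<bar> - A x)) \<longlongrightarrow> 0) (at t within {0..})"
  proof (rule Lim_null_comparison)
    show "((\<lambda>u. M * norm (q \<bar>u - t\<bar> - A x)) \<longlongrightarrow> 0) (at t within {0..})"
      using absq by (auto intro!: tendsto_eq_intros tendsto_norm_zero simp: LIM_zero_iff)
    show "\<forall>\<^sub>F u in at t within {0..}. norm (S (min u t) (q \<bar>u - t\<bar> - A x)) \<le> M * norm (q \<bar>u - t\<bar> - A x)"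
      unfolding eventually_at_filter using MB t by (auto intro!: always_eventually)
  qed
  then have "((\<lambda>u. S (min u t) (q \<bar>u - t\<bar> - A x) + S (min u t) (A x)) \<longlongrightarrow> 0 + S t (A x)) (at t within {0..})"
    using mincont by (rule tendsto_add)
  then have lim: "((\<lambda>u. S (min u t) (q \<bar>u - t\<bar> - A x) + S (min u t) (A x)) \<longlongrightarrow> S t (A x)) (at t within {0..})"
    by simp
  have "((\<lambda>u. (S u x - S t x) /\<^sub>R (u - t)) \<longlongrightarrow> S t (A x)) (at t within {0..})"
  proof (rule Lim_transform_eventually[OF lim])
    have "S (min u t) (q \<bar>u - t\<bar> - A x) + S (min u t) (A x) = (S u x - S t x) /\<^sub>R (u - t)"
      if u: "u \<noteq> t" "u \<ge> 0" for u
    proof -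
      interpret L: bounded_linear "S (min u t)" by (rule lin) (use u t in auto)
      have "S (min u t) (q \<bar>u - t\<bar> - A x) + S (min u t) (A x) = S (min u t) (q \<bar>u - t\<bar>)"
        by (simp add: L.diff)
      also have "\<dots> = (S (min u t) (S \<bar>u - t\<bar> x) - S (min u t) x) /\<^sub>R \<bar>u - t\<bar>"
        by (simp add: q_def L.diff L.scaleR)
      also have "\<dots> = (S (max u t) x - S (min u t) x) /\<^sub>R \<bar>u - t\<bar>"
      proof -
        have "min u t + \<bar>u - t\<bar> = max u t" by (simp add: min_def max_def)
        then show ?thesis using add[of "min u t" "\<bar>u - t\<bar>" x] u t by simp
      qed
      also have "\<dots> = (S u x - S t x) /\<^sub>R (u - t)"
      proof (cases "u \<le> t")
        case True
        then have "max u t = t" "min u t = u" "\<bar>u - t\<bar> = t - u" "inverse (u - t) = - inverse (t - u)"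
          by (auto simp flip: inverse_minus_eq)
        then show ?thesis by (simp add: scaleR_diff_right)
      qed (simp add: max_def min_def)
      finally show ?thesis .
    qed
    then show "\<forall>\<^sub>F u in at t within {0..}. S (min u t) (q \<bar>u - t\<bar> - A x) + S (min u t) (A x) = (S u x - S t x) /\<^sub>R (u - t)"
      unfolding eventually_at_filter by (auto intro!: always_eventually)
  qed
  then show ?thesis by (simp only: has_vector_derivative_iff_quotient)
qed

text \<open>
  The averages \<open>(1/h) \<integral>\<^sub>0\<^sup>h S t x dt\<close> tend to \<open>x\<close> as \<open>h \<longlongrightarrow> 0\<close>. They lie in the domain because \<open>S r\<close>
  merely shifts the window of integration, so that the difference quotient only sees its two ends.
\<close>

lemma generator_domain_dense:
  fixes S :: "real \<Rightarrow> 'a::banach \<Rightarrow> 'a"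
  assumes gen: "generates D A S"
  shows "closure D = UNIV"
proof -
  have C0: "C0_semigroup S" and D_eq: "D = {x. \<exists>y. ((\<lambda>h. (S h x - x) /\<^sub>R h) \<longlongrightarrow> y) (at_right 0)}"
    using gen by (simp_all only: generates_def)
  have lin: "bounded_linear (S t)" if "t \<ge> 0" for t using C0 that by (auto simp: C0_semigroup_def)
  have S0: "S 0 x = x" for x using C0 by (auto simp: C0_semigroup_def)
  have add: "S (s + t) x = S s (S t x)" if "s \<ge> 0" "t \<ge> 0" for s t x
    using C0 that by (auto simp: C0_semigroup_def)
  have cont: "continuous_on {0..b} (\<lambda>t. S t x)" for b x
    by (rule continuous_on_subset[OF C0_semigroup_continuous_on[OF C0]]) auto
  have "x \<in> closure D" for x
  proof -
    define \<Phi> where "\<Phi> h = integral {0..h} (\<lambda>t. S t x)" for h :: real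
    have \<Phi>': "((\<lambda>r. (\<Phi> (h + r) - \<Phi> h) /\<^sub>R r) \<longlongrightarrow> S h x) (at_right 0)" if "h \<ge> 0" for h
    proof -
      have "(\<Phi> has_vector_derivative S h x) (at h within {0..h+1})"
        unfolding \<Phi>_def[abs_def] using that by (intro integral_has_vector_derivative cont) auto
      then have "(\<Phi> has_vector_derivative S h x) (at h within {h..h+1})"
        by (rule has_vector_derivative_within_subset) (use that in auto)
      then have "((\<lambda>u. (\<Phi> u - \<Phi> h) /\<^sub>R (u - h)) \<longlongrightarrow> S h x) (at_right h)"
        by (simp add: has_vector_derivative_iff_quotient at_within_Icc_at_right)
      then show ?thesis by (subst (asm) filterlim_at_right_to_0) (simp add: add.commute)
    qed
    have \<Phi>0: "\<Phi> 0 = 0" by (simp add: \<Phi>_def)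
    have in_D: "\<Phi> h \<in> D" if h: "h \<ge> 0" for h
    proof -
      have shift: "S r (\<Phi> h) = \<Phi> (h + r) - \<Phi> r" if r: "r \<ge> 0" for r
      proof -
        have "S r (\<Phi> h) = integral {0..h} (S r \<circ> (\<lambda>t. S t x))"
          unfolding \<Phi>_def by (rule integral_linear[symmetric])
            (use r in \<open>auto intro!: lin integrable_continuous_real cont\<close>)
        also have "\<dots> = integral {0..h} ((\<lambda>t. S t x) \<circ> (+) r)"
          by (rule integral_cong) (use r in \<open>simp add: add\<close>)
        also have "\<dots> = integral {r..h + r} (\<lambda>t. S t x)"
          by (subst integral_shift_Icc_real) simp
        also have "\<dots> = \<Phi> (h + r) - \<Phi> r"
          using Henstock_Kurzweil_Integration.integral_combine[OF r _ integrable_continuous_real[OF cont[of "h + r" x]]] h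
          by (simp add: \<Phi>_def algebra_simps)
        finally show ?thesis .
      qed
      have "((\<lambda>r. (\<Phi> (h + r) - \<Phi> h) /\<^sub>R r - (\<Phi> (0 + r) - \<Phi> 0) /\<^sub>R r) \<longlongrightarrow> S h x - S 0 x) (at_right 0)"
        by (intro tendsto_diff \<Phi>' h order_refl)
      moreover have "\<forall>\<^sub>F r in at_right 0. (\<Phi> (h + r) - \<Phi> h) /\<^sub>R r - (\<Phi> (0 + r) - \<Phi> 0) /\<^sub>R r
          = (S r (\<Phi> h) - \<Phi> h) /\<^sub>R r"
        unfolding eventually_at_right_field
        by (intro exI[of _ 1]) (auto simp: shift \<Phi>0 scaleR_diff_right)
      ultimately have "((\<lambda>r. (S r (\<Phi> h) - \<Phi> h) /\<^sub>R r) \<longlongrightarrow> S h x - S 0 x) (at_right 0)"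
        by (rule Lim_transform_eventually)
      then show ?thesis using D_eq by auto
    qed
    have DA: "c *\<^sub>R v \<in> D" if v: "v \<in> D" for c v
    proof -
      obtain w where "((\<lambda>h. (S h v - v) /\<^sub>R h) \<longlongrightarrow> w) (at_right 0)"
        using v D_eq by auto
      then have "((\<lambda>h. c *\<^sub>R ((S h v - v) /\<^sub>R h)) \<longlongrightarrow> c *\<^sub>R w) (at_right 0)"
        by (intro tendsto_intros)
      moreover have "\<forall>\<^sub>F h in at_right 0. c *\<^sub>R ((S h v - v) /\<^sub>R h) = (S h (c *\<^sub>R v) - c *\<^sub>R v) /\<^sub>R h"
        unfolding eventually_at_right_field
        by (intro exI[of _ 1])
          (auto simp: linear_scale[OF bounded_linear.linear[OF lin]] scaleR_diff_right mult.commute)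
      ultimately have "((\<lambda>h. (S h (c *\<^sub>R v) - c *\<^sub>R v) /\<^sub>R h) \<longlongrightarrow> c *\<^sub>R w) (at_right 0)"
        by (rule Lim_transform_eventually)
      then show ?thesis using D_eq by auto
    qed
    have "((\<lambda>r. \<Phi> r /\<^sub>R r) \<longlongrightarrow> x) (at_right 0)" using \<Phi>'[of 0] by (simp add: \<Phi>0 S0)
    moreover have "\<forall>\<^sub>F r in at_right 0. \<Phi> r /\<^sub>R r \<in> closure D"
      unfolding eventually_at_right_field
      by (intro exI[of _ 1]) (auto intro!: subsetD[OF closure_subset] DA in_D)
    ultimately show ?thesis by (intro Lim_in_closed_set[of "closure D" _ "at_right 0"]) auto
  qed
  then show ?thesis by auto
qed

lemma dense_subset_eqI:
  fixes f g :: "'a::topological_space \<Rightarrow> 'b::t2_space"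
  assumes "closure D = UNIV" "continuous_on UNIV f" "continuous_on UNIV g" "\<And>x. x \<in> D \<Longrightarrow> f x = g x"
  shows "f x = g x"
proof -
  have "closure D \<subseteq> {x. f x = g x}"
    using assms by (intro closure_minimal closed_Collect_eq) auto
  then show ?thesis using assms(1) by auto
qed

section \<open>Symmetric coercive forms and Hilbert space adjoints\<close>

text \<open>
  The solution minimizes \<open>J x = b x x / 2 - l x\<close>: by the parallelogram identity and coercivity a
  minimizing sequence is Cauchy. For \<open>b\<close> the inner product this is the Riesz representation theorem,
  which gives adjoints; for the observability Gramian it gives the minimizer of the cost.
\<close>

lemma symmetric_Lax_Milgram:
  fixes b :: "'a::{real_inner,banach} \<Rightarrow> 'a \<Rightarrow> real"
  assumes bil: "bounded_bilinear b" and sym: "\<And>x y. b x y = b y x"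
    and \<delta>: "\<delta> > 0" and coercive: "\<And>x. b x x \<ge> \<delta> * (norm x)\<^sup>2"
    and l: "bounded_linear l"
  obtains x where "\<And>h. b x h = l h"
proof -
  interpret b: bounded_bilinear b by (rule bil)
  interpret l: bounded_linear l by (rule l)
  define J where "J x = b x x / 2 - l x" for x
  obtain L where L: "\<And>x. norm (l x) \<le> norm x * L" using l.bounded by blast
  have bdd: "J x \<ge> - L\<^sup>2 / (2 * \<delta>)" for x
  proof -
    have "0 \<le> (\<delta> * norm x - L)\<^sup>2 / (2 * \<delta>)" using \<delta> by simp
    also have "\<dots> = \<delta> * (norm x)\<^sup>2 / 2 - norm x * L + L\<^sup>2 / (2 * \<delta>)"
      using \<delta> by (simp add: field_simps power2_eq_square)
    finally show ?thesis using L[of x] coercive[of x] by (simp add: J_def abs_le_iff)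
  qed
  define m where "m = Inf (range J)"
  have m: "m \<le> J x" for x
    unfolding m_def by (rule cInf_lower) (auto intro!: bdd_belowI[of _ "- L\<^sup>2 / (2 * \<delta>)"] bdd)
  have "\<exists>x. J x < m + inverse (real (Suc n))" for n
    using cInf_lessD[of "range J" "m + inverse (real (Suc n))"] by (auto simp: m_def)
  then obtain u where u: "\<And>n. J (u n) < m + inverse (real (Suc n))" by metis
  have parallelogram: "\<delta> / 8 * (norm (v - w))\<^sup>2 \<le> J v / 2 + J w / 2 - m" for v w
  proof -
    have "J ((1/2) *\<^sub>R (v + w)) = J v / 2 + J w / 2 - b (v - w) (v - w) / 8"
      by (simp add: J_def b.add_left b.add_right b.diff_left b.diff_right b.scaleR_left b.scaleR_right
          l.add l.scaleR sym[of w v] field_simps)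
    then show ?thesis using m[of "(1/2) *\<^sub>R (v + w)"] coercive[of "v - w"] by simp
  qed
  have "Cauchy u"
  proof (rule metric_CauchyI)
    fix e :: real assume e: "e > 0"
    then have "\<delta> / 8 * e\<^sup>2 > 0" using \<delta> by simp
    then obtain N where N: "inverse (real (Suc N)) < \<delta> / 8 * e\<^sup>2"
      using reals_Archimedean by blast
    have "dist (u k) (u n) < e" if "k \<ge> N" "n \<ge> N" for k n
    proof -
      have "inverse (real (Suc k)) \<le> inverse (real (Suc N))" "inverse (real (Suc n)) \<le> inverse (real (Suc N))"
        using that by (simp_all add: le_imp_inverse_le)
      then have "\<delta> / 8 * (norm (u k - u n))\<^sup>2 < \<delta> / 8 * e\<^sup>2"
        using parallelogram[of "u k" "u n"] u[of k] u[of n] N by linarith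
      then have "(norm (u k - u n))\<^sup>2 < e\<^sup>2" using \<delta> by simp
      then show ?thesis using e by (simp add: dist_norm power_less_imp_less_base)
    qed
    then show "\<exists>M. \<forall>m\<ge>M. \<forall>n\<ge>M. dist (u m) (u n) < e" by blast
  qed
  then obtain x where x: "u \<longlonglongrightarrow> x" using Cauchy_convergent convergentD by blast
  have "(\<lambda>n. J (u n)) \<longlonglongrightarrow> J x" unfolding J_def
    by (intro tendsto_intros b.tendsto l.tendsto x) simp
  moreover have "(\<lambda>n. m + inverse (real (Suc n))) \<longlonglongrightarrow> m + 0"
    by (intro tendsto_intros LIMSEQ_inverse_real_of_nat)
  ultimately have "J x \<le> m + 0"
    by (rule LIMSEQ_le) (use u in \<open>auto intro: less_imp_le\<close>)
  then have min: "J x \<le> J v" for v using m[of v] by simp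
  show ?thesis
  proof (rule that)
    fix h
    define d where "d = b x h - l h"
    \<comment> \<open>First variation of \<open>J\<close> at the minimizer along \<open>h\<close>.\<close>
    have expand: "0 \<le> t * d + t\<^sup>2 * (b h h / 2)" for t
      using min[of "x + t *\<^sub>R h"]
      by (simp add: J_def d_def b.add_left b.add_right b.scaleR_left b.scaleR_right l.add l.scaleR
          sym[of h x] field_simps power2_eq_square)
    show "b x h = l h"
    proof (cases "h = 0")
      case True
      then show ?thesis by (simp add: b.zero_right l.zero)
    next
      case False
      then have p: "b h h > 0" using coercive[of h] \<delta>
        by (metis mult_pos_pos less_le_trans zero_less_norm_iff zero_less_power)
      have "0 \<le> - (d\<^sup>2) / (2 * b h h)"
        using expand[of "- d / b h h"] p by (simp add: field_simps power2_eq_square)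
      then have "d\<^sup>2 \<le> 0" using p by (simp add: field_simps)
      then show ?thesis by (simp add: d_def)
    qed
  qed
qed

lemma hilbert_adjoint:
  fixes F :: "'a::{real_inner,banach} \<Rightarrow> 'b::real_inner"
  assumes F: "bounded_linear F"
  shows "F x \<bullet> y = x \<bullet> adjoint F y"
proof -
  have "\<exists>w. \<forall>x. F x \<bullet> y = x \<bullet> w" for y
  proof -
    have "bounded_linear (\<lambda>x. F x \<bullet> y)"
      by (rule bounded_linear_compose[OF bounded_linear_inner_left F])
    from symmetric_Lax_Milgram[OF bounded_bilinear_inner inner_commute zero_less_one _ this]
    obtain w where "\<And>x. w \<bullet> x = F x \<bullet> y" by (auto simp: power2_norm_eq_inner)
    then show ?thesis by (metis inner_commute)
  qed
  then have "\<exists>f'. \<forall>x y. F x \<bullet> y = x \<bullet> f' y" by metis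
  then have "\<forall>x y. F x \<bullet> y = x \<bullet> adjoint F y" unfolding adjoint_def by (rule someI_ex)
  then show ?thesis by blast
qed

lemma inner_left_eqI:
  fixes v w :: "'a::real_inner"
  assumes "\<And>x. x \<bullet> v = x \<bullet> w"
  shows "v = w"
proof -
  have "(v - w) \<bullet> (v - w) = 0" using assms[of "v - w"] by (simp only: inner_diff_right)
  then show ?thesis by simp
qed

lemma bounded_linear_adjoint:
  fixes F :: "'a::{real_inner,banach} \<Rightarrow> 'b::real_inner"
  assumes F: "bounded_linear F"
  shows "bounded_linear (adjoint F)"
proof -
  note adj = hilbert_adjoint[OF F]
  obtain K where K: "K > 0" "\<And>x. norm (F x) \<le> norm x * K" using bounded_linear.pos_bounded[OF F] by blast
  show ?thesis
  proof (rule bounded_linear_intro)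
    show "adjoint F (x + y) = adjoint F x + adjoint F y" for x y
      by (rule inner_left_eqI) (simp add: adj[symmetric] inner_add_right)
    show "adjoint F (r *\<^sub>R x) = r *\<^sub>R adjoint F x" for r x
      by (rule inner_left_eqI) (simp add: adj[symmetric])
    show "norm (adjoint F y) \<le> norm y * K" for y
    proof (cases "adjoint F y = 0")
      case False
      have "norm (adjoint F y) * norm (adjoint F y) = F (adjoint F y) \<bullet> y"
        by (simp add: adj dot_square_norm power2_eq_square)
      also have "\<dots> \<le> norm (F (adjoint F y)) * norm y" by (rule norm_cauchy_schwarz)
      also have "\<dots> \<le> norm (adjoint F y) * K * norm y" using K by (intro mult_right_mono) auto
      finally show ?thesis using False by (simp add: mult.assoc mult.commute)
    qed (use K in simp)
  qed
qed

section \<open>Skew-adjoint generators and unitary groups\<close>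

definition skew_on :: "'a::real_inner set \<Rightarrow> ('a \<Rightarrow> 'a) \<Rightarrow> bool" where
  "skew_on D A \<longleftrightarrow> (\<forall>x\<in>D. \<forall>y\<in>D. A x \<bullet> y = - (x \<bullet> A y))"

lemma isometry_inner:
  fixes F :: "'a::real_inner \<Rightarrow> 'b::real_inner"
  assumes lin: "bounded_linear F" and iso: "\<And>x. norm (F x) = norm x"
  shows "F x \<bullet> F y = x \<bullet> y"
proof -
  have "F x + F y = F (x + y)" by (simp add: linear_add[OF bounded_linear.linear[OF lin]])
  then show ?thesis by (simp add: dot_norm iso)
qed

text \<open>
  The equation \<open>A\<^sup>* = -A\<close>, domains included, in a form free of the choice operator in
  \<open>adj_operator\<close>: the domain is dense, so the vector representing \<open>x \<mapsto> A x \<bullet> y\<close> is unique.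
\<close>

lemma skew_adjoint_generator_characterization:
  fixes A :: "'a::{real_inner,banach} \<Rightarrow> 'a"
  assumes gen: "generates D A S" and dom: "adj_domain D A = D"
    and skew: "\<And>x. x \<in> D \<Longrightarrow> A x + adj_operator D A x = 0"
  shows "y \<in> D \<and> w = - A y \<longleftrightarrow> (\<forall>x\<in>D. A x \<bullet> y = x \<bullet> w)"
proof -
  have unique: "v = w" if "\<forall>x\<in>D. A x \<bullet> y = x \<bullet> v" "\<forall>x\<in>D. A x \<bullet> y = x \<bullet> w" for y v w
  proof (rule inner_left_eqI)
    show "x \<bullet> v = x \<bullet> w" for x
      by (rule dense_subset_eqI[OF generator_domain_dense[OF gen]])
        (use that in \<open>auto intro!: continuous_intros\<close>)
  qed
  have adj: "\<forall>x\<in>D. A x \<bullet> y = x \<bullet> (- A y)" if y: "y \<in> D" for y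
  proof -
    obtain v where v: "\<forall>x\<in>D. A x \<bullet> y = x \<bullet> v" using y dom by (auto simp: adj_domain_def)
    have "adj_operator D A y = v" unfolding adj_operator_def
      by (rule the_equality) (use v unique in auto)
    then have "v = - A y" using skew[OF y] by (metis add_eq_0_iff2 minus_unique)
    with v show ?thesis by simp
  qed
  show ?thesis
  proof
    assume "\<forall>x\<in>D. A x \<bullet> y = x \<bullet> w"
    moreover from this have "y \<in> D" using dom by (auto simp: adj_domain_def)
    ultimately show "y \<in> D \<and> w = - A y" using unique adj by blast
  qed (use adj in auto)
qed

text \<open>
  On the domain, \<open>\<parallel>S t x\<parallel>\<^sup>2\<close> has derivative \<open>2 (S t x \<bullet> A (S t x)) = 0\<close>.
\<close>

lemma skew_semigroup_isometric:
  fixes S :: "real \<Rightarrow> 'a::{real_inner,banach} \<Rightarrow> 'a"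
  assumes gen: "generates D A S" and skew: "skew_on D A" and t: "t \<ge> 0"
  shows "norm (S t x) = norm x"
proof (rule dense_subset_eqI[OF generator_domain_dense[OF gen]])
  have C0: "C0_semigroup S" using gen by (simp add: generates_def)
  show "continuous_on UNIV (\<lambda>x. norm (S t x))"
    by (intro continuous_on_norm linear_continuous_on) (use C0 t in \<open>simp add: C0_semigroup_def\<close>)
  show "continuous_on UNIV (norm :: 'a \<Rightarrow> real)" by (intro continuous_intros)
  fix x assume x: "x \<in> D"
  have "((\<lambda>t. S t x \<bullet> S t x) has_vector_derivative 0) (at t within {0..})" if "t \<in> {0..}" for t
  proof -
    have "((\<lambda>t. S t x \<bullet> S t x) has_vector_derivative S t x \<bullet> S t (A x) + S t (A x) \<bullet> S t x) (at t within {0..})"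
      by (intro bounded_bilinear.has_vector_derivative[OF bounded_bilinear_inner]
          orbit_has_vector_derivative[OF gen x]) (use that in auto)
    moreover have "S t x \<bullet> S t (A x) + S t (A x) \<bullet> S t x = 0"
      using generator_invariant[OF gen x, of t] skew that by (auto simp: skew_on_def)
    ultimately show ?thesis by simp
  qed
  then obtain c where "\<And>t. t \<in> {0..} \<Longrightarrow> S t x \<bullet> S t x = c"
    using has_vector_derivative_zero_constant[OF convex_real_interval(1)] by blast
  then have "S t x \<bullet> S t x = S 0 x \<bullet> S 0 x" using t by auto
  then show "norm (S t x) = norm x"
    using C0 by (simp add: C0_semigroup_def norm_eq_sqrt_inner)
qed

text \<open>
  Supplies a semigroup generated by \<open>- A\<close>, without which \<open>exp_semigroup D (\<lambda>x. - A x)\<close> would be an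
  arbitrary function. As \<open>S t\<close> is isometric, its adjoint \<open>V t\<close> is a left inverse; this yields the strong
  continuity of \<open>V\<close> and \<open>V h x - x = - V h (S h x - x)\<close>, hence \<open>- A\<close> as the derivative on \<open>D\<close>.
  Conversely, a vector at which \<open>V\<close> is differentiable lies in the domain of \<open>A\<^sup>*\<close>, which is \<open>D\<close>.
\<close>

lemma adjoint_semigroup_generates_uminus:
  fixes S :: "real \<Rightarrow> 'a::{real_inner,banach} \<Rightarrow> 'a"
  assumes gen: "generates D A S"
    and char: "\<And>y w. y \<in> D \<and> w = - A y \<longleftrightarrow> (\<forall>x\<in>D. A x \<bullet> y = x \<bullet> w)"
  shows "generates D (\<lambda>x. - A x) (\<lambda>t. adjoint (S t))"
proof -
  define V where "V t = adjoint (S t)" for t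
  have C0: "C0_semigroup S" using gen by (simp add: generates_def)
  have S0: "S 0 x = x" for x using C0 by (auto simp: C0_semigroup_def)
  have lin: "bounded_linear (S t)" if "t \<ge> 0" for t using C0 that by (auto simp: C0_semigroup_def)
  have adj: "S t x \<bullet> y = x \<bullet> V t y" if "t \<ge> 0" for t x y
    unfolding V_def by (rule hilbert_adjoint[OF lin[OF that]])
  have linV: "bounded_linear (V t)" if "t \<ge> 0" for t
    unfolding V_def by (rule bounded_linear_adjoint[OF lin[OF that]])
  have skew: "skew_on D A" unfolding skew_on_def using char by (metis inner_minus_right)
  have iso: "norm (S t x) = norm x" if "t \<ge> 0" for t x
    by (rule skew_semigroup_isometric[OF gen skew that])
  have VS: "V t (S t x) = x" if "t \<ge> 0" for t x
    by (rule inner_left_eqI) (simp add: adj[OF that, symmetric] isometry_inner[OF lin[OF that] iso[OF that]])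
  have contractive: "norm (V t x) \<le> norm x" if t: "t \<ge> 0" for t x
  proof (cases "V t x = 0")
    case False
    have "norm (V t x) * norm (V t x) = S t (V t x) \<bullet> x"
      by (simp add: adj[OF t] dot_square_norm power2_eq_square)
    also have "\<dots> \<le> norm (S t (V t x)) * norm x" by (rule norm_cauchy_schwarz)
    finally show ?thesis using False by (simp add: iso[OF t])
  qed simp
  have contV: "((\<lambda>t. V t x) \<longlongrightarrow> x) (at_right 0)" for x
  proof -
    have "((\<lambda>t. sqrt (2 * norm x * norm (S t x - x))) \<longlongrightarrow> sqrt (2 * norm x * norm (x - x))) (at_right 0)"
      using C0 by (intro tendsto_intros) (auto simp: C0_semigroup_def)
    then have "((\<lambda>t. V t x - x) \<longlongrightarrow> 0) (at_right 0)"
    proof (rule Lim_null_comparison[rotated, OF tendsto_eq_rhs])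
      have "norm (V t x - x) \<le> sqrt (2 * norm x * norm (S t x - x))" if t: "t > 0" for t
      proof (rule real_le_rsqrt)
        have "(norm (V t x - x))\<^sup>2 = (norm (V t x))\<^sup>2 - 2 * (x \<bullet> V t x) + (norm x)\<^sup>2"
          by (simp add: power2_norm_eq_inner inner_diff_left inner_diff_right inner_commute)
        also have "\<dots> \<le> (norm x)\<^sup>2 - 2 * (S t x \<bullet> x) + (norm x)\<^sup>2"
          using contractive[of t x] t adj[of t x x] by (simp add: power_mono)
        also have "\<dots> = 2 * ((x - S t x) \<bullet> x)"
          by (simp add: power2_norm_eq_inner inner_diff_left)
        also have "\<dots> \<le> 2 * (norm (x - S t x) * norm x)"
          by (intro mult_left_mono norm_cauchy_schwarz) simp
        finally show "(norm (V t x - x))\<^sup>2 \<le> 2 * norm x * norm (S t x - x)"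
          by (simp add: norm_minus_commute mult.commute mult.left_commute)
      qed
      then show "\<forall>\<^sub>F t in at_right 0. norm (V t x - x) \<le> sqrt (2 * norm x * norm (S t x - x))"
        unfolding eventually_at_right_field by (intro exI[of _ 1]) auto
    qed simp
    then show ?thesis by (simp add: LIM_zero_iff)
  qed
  have C0V: "C0_semigroup V"
    unfolding C0_semigroup_def
  proof (intro conjI allI impI)
    show "V 0 x = x" for x
      by (rule inner_left_eqI) (simp add: adj[symmetric] S0)
    show "V (s + t) x = V s (V t x)" if "0 \<le> s" "0 \<le> t" for s t x
    proof (rule inner_left_eqI)
      fix v
      have "S (t + s) v = S t (S s v)" using C0 that by (simp add: C0_semigroup_def)
      then show "v \<bullet> V (s + t) x = v \<bullet> V s (V t x)"
        using that by (simp add: adj[symmetric] add.commute)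
    qed
  qed (use linV contV in auto)
  have limD: "((\<lambda>h. (V h x - x) /\<^sub>R h) \<longlongrightarrow> - A x) (at_right 0)" if x: "x \<in> D" for x
  proof -
    have lim: "((\<lambda>h. (S h x - x) /\<^sub>R h) \<longlongrightarrow> A x) (at_right 0)" using gen x by (simp add: generates_def)
    have "((\<lambda>h. V h ((S h x - x) /\<^sub>R h - A x)) \<longlongrightarrow> 0) (at_right 0)"
    proof (rule Lim_null_comparison)
      show "((\<lambda>h. norm ((S h x - x) /\<^sub>R h - A x)) \<longlongrightarrow> 0) (at_right 0)"
        using lim by (intro tendsto_norm_zero) (simp add: LIM_zero_iff)
      show "\<forall>\<^sub>F h in at_right 0. norm (V h ((S h x - x) /\<^sub>R h - A x)) \<le> norm ((S h x - x) /\<^sub>R h - A x)"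
        unfolding eventually_at_right_field by (intro exI[of _ 1]) (auto intro: contractive)
    qed
    then have "((\<lambda>h. - (V h ((S h x - x) /\<^sub>R h - A x)) - V h (A x)) \<longlongrightarrow> - 0 - A x) (at_right 0)"
      by (intro tendsto_intros contV)
    moreover have "\<forall>\<^sub>F h in at_right 0. - (V h ((S h x - x) /\<^sub>R h - A x)) - V h (A x) = (V h x - x) /\<^sub>R h"
      unfolding eventually_at_right_field
    proof (intro exI[of _ 1] conjI allI impI)
      fix h :: real assume "0 < h" "h < 1"
      then have h: "h \<ge> 0" by simp
      interpret Vh: bounded_linear "V h" by (rule linV[OF h])
      show "- (V h ((S h x - x) /\<^sub>R h - A x)) - V h (A x) = (V h x - x) /\<^sub>R h"
        by (simp add: Vh.diff Vh.scaleR VS[OF h] scaleR_diff_right)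
    qed simp
    ultimately show ?thesis by (simp add: Lim_transform_eventually)
  qed
  have "x \<in> D" if "((\<lambda>h. (V h x - x) /\<^sub>R h) \<longlongrightarrow> w) (at_right 0)" for x w
  proof -
    have "A u \<bullet> x = u \<bullet> w" if u: "u \<in> D" for u
    proof -
      have "((\<lambda>h. (S h u - u) /\<^sub>R h) \<longlongrightarrow> A u) (at_right 0)" using gen u by (simp add: generates_def)
      then have "((\<lambda>h. ((S h u - u) /\<^sub>R h) \<bullet> x) \<longlongrightarrow> A u \<bullet> x) (at_right 0)"
        by (intro tendsto_intros)
      moreover have "\<forall>\<^sub>F h in at_right 0. ((S h u - u) /\<^sub>R h) \<bullet> x = u \<bullet> ((V h x - x) /\<^sub>R h)"
        unfolding eventually_at_right_field
        by (intro exI[of _ 1]) (auto simp: inner_diff_left inner_diff_right adj)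
      ultimately have "((\<lambda>h. u \<bullet> ((V h x - x) /\<^sub>R h)) \<longlongrightarrow> A u \<bullet> x) (at_right 0)"
        by (rule Lim_transform_eventually)
      moreover have "((\<lambda>h. u \<bullet> ((V h x - x) /\<^sub>R h)) \<longlongrightarrow> u \<bullet> w) (at_right 0)"
        using \<open>((\<lambda>h. (V h x - x) /\<^sub>R h) \<longlongrightarrow> w) (at_right 0)\<close> by (intro tendsto_intros)
      ultimately show ?thesis using tendsto_unique[OF trivial_limit_at_right_real] by blast
    qed
    then show ?thesis using char by blast
  qed
  then have "D = {x. \<exists>y. ((\<lambda>h. (V h x - x) /\<^sub>R h) \<longlongrightarrow> y) (at_right 0)}" using limD by blast
  then show ?thesis
    unfolding generates_def V_def[symmetric] using C0V limD by blast
qed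

text \<open>
  For \<open>x\<close> and \<open>y\<close> in the domain, \<open>S s x \<bullet> R (t - s) y\<close> has derivative zero in \<open>s\<close>; compare \<open>s = 0\<close>
  with \<open>s = t\<close>.
\<close>

lemma skew_semigroups_dual:
  fixes S R :: "real \<Rightarrow> 'a::{real_inner,banach} \<Rightarrow> 'a"
  assumes S: "generates D A S" and R: "generates D (\<lambda>x. - A x) R"
    and skew: "skew_on D A" and t: "t \<ge> 0"
  shows "S t x \<bullet> y = x \<bullet> R t y"
proof -
  have linS: "bounded_linear (S t)" and linR: "bounded_linear (R t)"
    using S R t by (auto simp: generates_def C0_semigroup_def)
  have core: "S t x \<bullet> y = x \<bullet> R t y" if x: "x \<in> D" and y: "y \<in> D" for x y
  proof -
    have "((\<lambda>s. S s x \<bullet> R (t - s) y) has_vector_derivative 0) (at s within {0..t})"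
      if s: "s \<in> {0..t}" for s
    proof -
      have "((R' \<circ> (\<lambda>s. t - s)) has_vector_derivative (-1) *\<^sub>R R (t - s) (- A y)) (at s within {0..t})"
        if "R' = (\<lambda>t. R t y)" for R'
      proof (rule vector_diff_chain_within)
        show "((\<lambda>s. t - s) has_vector_derivative -1) (at s within {0..t})"
          by (auto intro!: derivative_eq_intros)
        show "(R' has_vector_derivative R (t - s) (- A y)) (at (t - s) within (\<lambda>s. t - s) ` {0..t})"
          unfolding that
          by (rule has_vector_derivative_within_subset[OF orbit_has_vector_derivative[OF R y]]) (use s in auto)
      qed
      then have R': "((\<lambda>s. R (t - s) y) has_vector_derivative - R (t - s) (- A y)) (at s within {0..t})"
        by (simp add: o_def)
      have S': "((\<lambda>s. S s x) has_vector_derivative S s (A x)) (at s within {0..t})"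
        by (rule has_vector_derivative_within_subset[OF orbit_has_vector_derivative[OF S x]]) (use s in auto)
      have "((\<lambda>s. S s x \<bullet> R (t - s) y) has_vector_derivative
          (S s x \<bullet> - R (t - s) (- A y) + S s (A x) \<bullet> R (t - s) y)) (at s within {0..t})"
        by (rule bounded_bilinear.has_vector_derivative[OF bounded_bilinear_inner S' R'])
      moreover have "S s x \<bullet> - R (t - s) (- A y) + S s (A x) \<bullet> R (t - s) y = 0"
        using generator_invariant(1)[OF S x, of s] generator_invariant(1)[OF R y, of "t - s"] s skew
        by (simp add: generator_invariant(2)[OF S x, symmetric] generator_invariant(2)[OF R y, symmetric]
            skew_on_def)
      ultimately show ?thesis by simp
    qed
    then obtain c where c: "\<And>s. s \<in> {0..t} \<Longrightarrow> S s x \<bullet> R (t - s) y = c"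
      using has_vector_derivative_zero_constant[OF convex_real_interval(5)] by blast
    then have "S t x \<bullet> R (t - t) y = S 0 x \<bullet> R (t - 0) y" using c[of t] c[of 0] t by simp
    then show ?thesis using S R by (simp add: generates_def C0_semigroup_def)
  qed
  note contS = linear_continuous_on[OF linS, of UNIV] and contR = linear_continuous_on[OF linR, of UNIV]
  have right: "S t x \<bullet> y = x \<bullet> R t y" if x: "x \<in> D" for x y
  proof (rule dense_subset_eqI[OF generator_domain_dense[OF S], where f = "\<lambda>y. S t x \<bullet> y"])
    show "continuous_on UNIV (\<lambda>y. S t x \<bullet> y)" "continuous_on UNIV (\<lambda>y. x \<bullet> R t y)"
      by (intro continuous_on_inner continuous_on_const continuous_on_id contR)+
  qed (rule core[OF x])
  show ?thesis
  proof (rule dense_subset_eqI[OF generator_domain_dense[OF S], where f = "\<lambda>x. S t x \<bullet> y"])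
    show "continuous_on UNIV (\<lambda>x. S t x \<bullet> y)" "continuous_on UNIV (\<lambda>x. x \<bullet> R t y)"
      by (intro continuous_on_inner continuous_on_const continuous_on_id contS)+
  qed (rule right)
qed

locale unitary_group =
  fixes G :: "real \<Rightarrow> 'a::{real_inner,banach} \<Rightarrow> 'a"
  assumes linear: "bounded_linear (G t)"
    and isometric: "norm (G t x) = norm x"
    and zero: "G 0 x = x"
    and add: "G (s + t) x = G s (G t x)"
    and continuous: "continuous_on UNIV (\<lambda>t. G t x)"

text \<open>
  One half of Stone's theorem. Each of the two semigroups is isometric and the adjoint of the other, so
  they are inverse to each other and can be glued at \<open>t = 0\<close> into a group.
\<close>

lemma Stone_group:
  fixes A :: "'a::{real_inner,banach} \<Rightarrow> 'a"
  assumes gen: "generates_contraction_semigroup D A" and dom: "adj_domain D A = D"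
    and skew: "\<And>x. x \<in> D \<Longrightarrow> A x + adj_operator D A x = 0"
  obtains G where "unitary_group G" "\<And>t. t \<ge> 0 \<Longrightarrow> exp_semigroup D A t = G t"
    "\<And>t. t \<ge> 0 \<Longrightarrow> exp_semigroup D (\<lambda>x. - A x) t = G (- t)"
proof -
  define S where "S = exp_semigroup D A"
  define R where "R = exp_semigroup D (\<lambda>x. - A x)"
  have genS: "generates D A S"
    using gen unfolding generates_contraction_semigroup_def S_def exp_semigroup_def by (metis someI_ex)
  note char = skew_adjoint_generator_characterization[OF genS dom skew]
  have sk: "skew_on D A" unfolding skew_on_def using char by (metis inner_minus_right)
  have "\<exists>R. generates D (\<lambda>x. - A x) R"
    using adjoint_semigroup_generates_uminus[OF genS char] by blast
  then have genR: "generates D (\<lambda>x. - A x) R" unfolding R_def exp_semigroup_def by (rule someI_ex)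
  have skR: "skew_on D (\<lambda>x. - A x)" using sk by (auto simp: skew_on_def)
  have C0: "C0_semigroup S" "C0_semigroup R" using genS genR by (auto simp: generates_def)
  have linS: "bounded_linear (S t)" and linR: "bounded_linear (R t)" if "t \<ge> 0" for t
    using C0 that by (auto simp: C0_semigroup_def)
  have S0: "S 0 x = x" and R0: "R 0 x = x" for x using C0 by (auto simp: C0_semigroup_def)
  have addS: "S (s + t) x = S s (S t x)" and addR: "R (s + t) x = R s (R t x)"
    if "s \<ge> 0" "t \<ge> 0" for s t x using C0 that by (auto simp: C0_semigroup_def)
  have isoS: "norm (S t x) = norm x" and isoR: "norm (R t x) = norm x" if "t \<ge> 0" for t x
    using skew_semigroup_isometric[OF genS sk that] skew_semigroup_isometric[OF genR skR that] by auto
  have dual: "S t x \<bullet> y = x \<bullet> R t y" if "t \<ge> 0" for t x y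
    by (rule skew_semigroups_dual[OF genS genR sk that])
  have RS: "R t (S t x) = x" if "t \<ge> 0" for t x
    by (rule inner_left_eqI)
      (simp add: dual[OF that, symmetric] isometry_inner[OF linS[OF that] isoS[OF that]])
  have SR: "S t (R t x) = x" if "t \<ge> 0" for t x
    by (rule inner_left_eqI)
      (metis dual[OF that] inner_commute isometry_inner[OF linR[OF that] isoR[OF that]])
  define G where "G t = (if t \<ge> 0 then S t else R (- t))" for t
  have GR: "G (- t) = R t" if "t \<ge> 0" for t
    using that S0 R0 by (cases "t = 0") (auto simp: G_def)
  have linG: "bounded_linear (G t)" for t using linS[of t] linR[of "- t"] by (auto simp: G_def)
  have isoG: "norm (G t x) = norm x" for t x using isoS[of t] isoR[of "- t"] by (auto simp: G_def)
  have G0: "G 0 x = x" for x by (simp add: G_def S0)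
  have SR_diff: "S s (R t x) = G (s - t) x \<and> R t (S s x) = G (s - t) x" if "s \<ge> 0" "t \<ge> 0" for s t x
  proof (cases "s \<ge> t")
    case True
    then show ?thesis
      using addS[of "s - t" t "R t x"] addS[of t "s - t" x] that by (simp add: SR RS G_def)
  next
    case False
    then show ?thesis
      using addR[of "t - s" s "S s x"] addR[of s "t - s" x] that by (simp add: SR RS G_def)
  qed
  have addG: "G (s + t) x = G s (G t x)" for s t x
  proof (cases "s \<ge> 0"; cases "t \<ge> 0")
    assume "s \<ge> 0" "\<not> t \<ge> 0"
    then show ?thesis using SR_diff[of s "- t" x] by (simp add: G_def)
  next
    assume "\<not> s \<ge> 0" "t \<ge> 0"
    then show ?thesis using SR_diff[of t "- s" x] by (simp add: G_def add.commute)
  next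
    assume "\<not> s \<ge> 0" "\<not> t \<ge> 0"
    then show ?thesis using addR[of "- s" "- t" x] by (simp add: G_def add.commute)
  qed (simp add: G_def addS)
  have contG: "continuous_on UNIV (\<lambda>t. G t x)" for x
  proof -
    have "continuous_on ({0..} \<union> {..0}) (\<lambda>t. G t x)"
    proof (rule continuous_on_closed_Un)
      show "continuous_on {0..} (\<lambda>t. G t x)"
        using C0_semigroup_continuous_on[OF C0(1)]
        by (rule continuous_on_eq) (simp add: G_def)
      have "continuous_on {..0} (\<lambda>t. R (- t) x)"
        by (rule continuous_on_compose2[OF C0_semigroup_continuous_on[OF C0(2)]])
          (auto intro!: continuous_intros)
      then show "continuous_on {..0} (\<lambda>t. G t x)"
        by (rule continuous_on_eq) (metis GR atMost_iff minus_minus neg_0_le_iff_le)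
    qed auto
    moreover have "{0..} \<union> {..0} = (UNIV :: real set)" by auto
    ultimately show ?thesis by simp
  qed
  show ?thesis
  proof (rule that)
    show "unitary_group G" by (intro unitary_group.intro linG isoG G0 addG contG)
    show "exp_semigroup D A t = G t" if "t \<ge> 0" for t using that by (simp add: G_def S_def)
    show "exp_semigroup D (\<lambda>x. - A x) t = G (- t)" if "t \<ge> 0" for t using GR[OF that] by (simp add: R_def)
  qed
qed

section \<open>Bochner integrals over compact intervals\<close>

lemma set_integrable_bounded_linear:
  fixes g :: "'c \<Rightarrow> 'a::{banach,second_countable_topology}" and L :: "'a \<Rightarrow> 'b::{banach,second_countable_topology}"
  assumes L: "bounded_linear L" and g: "set_integrable M I g"
  shows "set_integrable M I (\<lambda>s. L (g s))"
    and "(LINT s:I|M. L (g s)) = L (LINT s:I|M. g s)"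
proof -
  have eq: "indicator I s *\<^sub>R L (g s) = L (indicator I s *\<^sub>R g s)" for s
    by (simp add: linear_scale[OF bounded_linear.linear[OF L]])
  show "set_integrable M I (\<lambda>s. L (g s))"
    using integrable_bounded_linear[OF L g[unfolded set_integrable_def]]
    by (simp add: set_integrable_def eq)
  show "(LINT s:I|M. L (g s)) = L (LINT s:I|M. g s)"
    using integral_bounded_linear[OF L g[unfolded set_integrable_def]]
    by (simp add: set_lebesgue_integral_def eq)
qed

lemma set_integral_inner:
  fixes g :: "'c \<Rightarrow> 'a::{real_inner,banach,second_countable_topology}"
  assumes "set_integrable M I g"
  shows "set_integrable M I (\<lambda>s. g s \<bullet> h)"
    and "(LINT s:I|M. g s \<bullet> h) = (LINT s:I|M. g s) \<bullet> h"
  using set_integrable_bounded_linear[OF bounded_linear_inner_left assms] by auto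

lemma set_integral_norm_le:
  fixes g :: "'c \<Rightarrow> 'a::{banach,second_countable_topology}"
  assumes "set_integrable M I g"
  shows "norm (LINT s:I|M. g s) \<le> (LINT s:I|M. norm (g s))"
  using integral_norm_bound[of M "\<lambda>s. indicator I s *\<^sub>R g s"]
  by (simp add: set_lebesgue_integral_def)

lemma set_integrable_norm:
  fixes g :: "'c \<Rightarrow> 'a::{banach,second_countable_topology}"
  assumes "set_integrable M I g"
  shows "set_integrable M I (\<lambda>s. norm (g s))"
  using integrable_norm[OF assms[unfolded set_integrable_def]] by (simp add: set_integrable_def)

lemma set_integral_split_Icc:
  fixes g :: "real \<Rightarrow> 'a::{banach,second_countable_topology}"
  assumes g: "set_integrable lebesgue {a..b} g" and c: "a \<le> c" "c \<le> b"
  shows "(LINT s:{a..b}|lebesgue. g s) = (LINT s:{a..c}|lebesgue. g s) + (LINT s:{c..b}|lebesgue. g s)"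
proof -
  have "{a..b} = {a..c} \<union> {c..b}" using c by auto
  then have "(LINT s:{a..b}|lebesgue. g s) = (LINT s:{a..c} \<union> {c..b}|lebesgue. g s)" by simp
  also have "\<dots> = (LINT s:{a..c}|lebesgue. g s) + (LINT s:{c..b}|lebesgue. g s)"
  proof (rule set_integral_Un_AE)
    have "AE x in lebesgue. x \<noteq> c" by (rule AE_I'[of "{c}"]) auto
    then show "AE x in lebesgue. \<not> (x \<in> {a..c} \<and> x \<in> {c..b})" by eventually_elim auto
  qed (use c in \<open>auto intro!: set_integrable_subset[OF g]\<close>)
  finally show ?thesis .
qed

text \<open>
  The increments are dominated by those of the indefinite integral of the norm, a real function
  for which continuity is known.
\<close>

lemma continuous_on_indefinite_integral:
  fixes g :: "real \<Rightarrow> 'a::{banach,second_countable_topology}"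
  assumes g: "set_integrable lebesgue {0..T} g"
  shows "continuous_on {0..T} (\<lambda>t. LINT s:{0..t}|lebesgue. g s)"
proof -
  define h where "h t = integral {0..t} (\<lambda>s. norm (g s))" for t
  note n = set_integrable_norm[OF g]
  have h_eq: "(LINT s:{0..t}|lebesgue. norm (g s)) = h t" if "t \<in> {0..T}" for t
    unfolding h_def by (rule set_lebesgue_integral_eq_integral(2)[OF set_integrable_subset[OF n]])
      (use that in auto)
  have h: "continuous_on {0..T} h" unfolding h_def
    by (rule indefinite_integral_continuous_1[OF set_lebesgue_integral_eq_integral(1)[OF n]])
  have le: "dist (LINT s:{0..t}|lebesgue. g s) (LINT s:{0..u}|lebesgue. g s) \<le> dist (h t) (h u)"
    if "t \<in> {0..T}" "u \<in> {0..T}" "t \<le> u" for t u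
  proof -
    have gu: "set_integrable lebesgue {0..u} g" by (rule set_integrable_subset[OF g]) (use that in auto)
    have gtu: "set_integrable lebesgue {t..u} g" by (rule set_integrable_subset[OF g]) (use that in auto)
    have "(LINT s:{0..u}|lebesgue. g s) - (LINT s:{0..t}|lebesgue. g s) = (LINT s:{t..u}|lebesgue. g s)"
      using set_integral_split_Icc[OF gu, of t] that by simp
    moreover have "h u - h t = (LINT s:{t..u}|lebesgue. norm (g s))"
      using set_integral_split_Icc[OF set_integrable_norm[OF gu], of t] that by (simp add: h_eq)
    ultimately have "norm ((LINT s:{0..u}|lebesgue. g s) - (LINT s:{0..t}|lebesgue. g s)) \<le> norm (h u - h t)"
      using set_integral_norm_le[OF gtu] by simp
    then show ?thesis by (metis dist_norm dist_commute)
  qed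
  show ?thesis unfolding continuous_on_iff
  proof (intro ballI allI impI)
    fix t e :: real assume t: "t \<in> {0..T}" and "e > 0"
    then obtain d where d: "d > 0" "\<And>u. u \<in> {0..T} \<Longrightarrow> dist u t < d \<Longrightarrow> dist (h u) (h t) < e"
      using h unfolding continuous_on_iff by blast
    have "dist (LINT s:{0..u}|lebesgue. g s) (LINT s:{0..t}|lebesgue. g s) < e"
      if u: "u \<in> {0..T}" "dist u t < d" for u
      using le[of t u] le[of u t] d(2)[OF u] u t
      by (cases "t \<le> u") (auto simp: dist_commute)
    then show "\<exists>d>0. \<forall>u\<in>{0..T}. dist u t < d \<longrightarrow>
        dist (LINT s:{0..u}|lebesgue. g s) (LINT s:{0..t}|lebesgue. g s) < e"
      using d(1) by blast
  qed
qed

lemma set_integral_reflect: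
  fixes g :: "real \<Rightarrow> 'a::{banach,second_countable_topology}"
  assumes g: "set_integrable lebesgue {a..b} g"
  shows "set_integrable lebesgue {c - b..c - a} (\<lambda>s. g (c - s))"
    and "(LINT s:{c - b..c - a}|lebesgue. g (c - s)) = (LINT s:{a..b}|lebesgue. g s)"
proof -
  define k where "k s = indicator {a..b} s *\<^sub>R g s" for s
  have k: "integrable lebesgue k" using g by (simp add: set_integrable_def k_def[abs_def])
  have km: "k \<in> borel_measurable lebesgue" using k by auto
  have eq: "indicator {c - b..c - a} s *\<^sub>R g (c - s) = k (c - s)" for s
    by (auto simp: k_def indicator_def)
  have meas: "(\<lambda>s. c - s) \<in> lebesgue \<rightarrow>\<^sub>M lebesgue"
    using lebesgue_affine_measurable[where c = "\<lambda>_::real. -1" and t = c] by simp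
  have leb: "distr lebesgue lebesgue (\<lambda>s. c - s) = lebesgue"
    using lebesgue_real_affine[of "-1" c] by (simp add: density_1)
  show "set_integrable lebesgue {c - b..c - a} (\<lambda>s. g (c - s))"
    unfolding set_integrable_def eq
    using integrable_distr[OF meas, of k] k by (simp add: leb)
  show "(LINT s:{c - b..c - a}|lebesgue. g (c - s)) = (LINT s:{a..b}|lebesgue. g s)"
    unfolding set_lebesgue_integral_def eq k_def[symmetric]
    using integral_distr[OF meas km] by (simp add: leb)
qed

lemma set_integrable_continuous_Icc:
  fixes g :: "real \<Rightarrow> 'a::{banach,second_countable_topology}"
  assumes g: "continuous_on {a..b} g"
  shows "set_integrable lebesgue {a..b} g"
proof -
  have "set_integrable lborel {a..b} g"
    unfolding set_integrable_def by (rule borel_integrable_compact[OF compact_Icc g])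
  then show ?thesis by (simp add: set_integrable_def integrable_completion borel_measurable_integrable)
qed

lemma L2_on_integrable:
  assumes y: "L2_on {a..b} y"
  shows "set_integrable lebesgue {a..b} y"
proof (rule set_integrable_bound)
  show "set_integrable lebesgue {a..b} (\<lambda>s. 1 + (norm (y s))\<^sup>2)"
    using y by (intro set_integral_add(1)[OF set_integrable_continuous_Icc[OF continuous_on_const]])
      (simp add: L2_on_def)
  show "set_borel_measurable lebesgue {a..b} y" using y by (simp add: L2_on_def)
  have "norm (y s) \<le> 1 + (norm (y s))\<^sup>2" for s
  proof -
    have "2 * norm (y s) \<le> 1 + (norm (y s))\<^sup>2" using sum_squares_bound[of 1 "norm (y s)"] by simp
    then show ?thesis using norm_ge_zero[of "y s"] by linarith
  qed
  then show "AE s in lebesgue. s \<in> {a..b} \<longrightarrow> norm (y s) \<le> norm (1 + (norm (y s))\<^sup>2)"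
    by (auto intro!: AE_I2 order_trans[OF _ abs_ge_self])
qed

lemma set_integral_singleton:
  fixes g :: "real \<Rightarrow> 'a::{banach,second_countable_topology}"
  shows "(LINT s:{a}|lebesgue. g s) = 0"
proof -
  have "AE s in lebesgue. s \<noteq> a" by (rule AE_I'[of "{a}"]) auto
  then have "AE s in lebesgue. indicator {a} s *\<^sub>R g s = 0" by eventually_elim auto
  then show ?thesis unfolding set_lebesgue_integral_def by (rule integral_eq_zero_AE)
qed

lemma set_integral_norm_le_const:
  fixes g :: "real \<Rightarrow> 'a::{banach,second_countable_topology}"
  assumes g: "set_integrable lebesgue {0..T} g" and T: "T \<ge> 0"
    and b: "\<And>s. s \<in> {0..T} \<Longrightarrow> norm (g s) \<le> b"
  shows "norm (LINT s:{0..T}|lebesgue. g s) \<le> b * T"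
proof -
  have "norm (LINT s:{0..T}|lebesgue. g s) \<le> (LINT s:{0..T}|lebesgue. norm (g s))"
    by (rule set_integral_norm_le[OF g])
  also have "\<dots> \<le> (LINT s:{0..T}|lebesgue. b)"
    by (rule set_integral_mono[OF set_integrable_norm[OF g] set_integrable_continuous_Icc b])
      (auto intro: continuous_intros)
  also have "\<dots> = b * T" using T by (simp add: set_lebesgue_integral_def)
  finally show ?thesis .
qed

section \<open>Unitary groups acting on integrable functions\<close>

context unitary_group begin

lemma add_apply: "G s (G t x) = G (s + t) x" by (simp add: add)

lemma inverse_apply [simp]: "G (- t) (G t x) = x" "G t (G (- t) x) = x"
  by (simp_all add: add_apply zero)

lemma adjoint_eq: "G t x \<bullet> y = x \<bullet> G (- t) y"
  using isometry_inner[OF linear isometric, of t x "G (- t) y"] by simp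

lemma linear_simps [simp]:
  "G t (x + y) = G t x + G t y" "G t (x - y) = G t x - G t y" "G t (- x) = - G t x"
  "G t 0 = 0" "G t (r *\<^sub>R x) = r *\<^sub>R G t x"
proof -
  interpret L: bounded_linear "G t" by (rule linear)
  show "G t (x + y) = G t x + G t y" "G t (x - y) = G t x - G t y" "G t (- x) = - G t x"
    "G t 0 = 0" "G t (r *\<^sub>R x) = r *\<^sub>R G t x"
    by (simp_all add: L.add L.diff L.neg L.scaleR L.zero)
qed

text \<open>
  Isometry makes strong continuity uniform in the vector. Joint continuity is what makes
  \<open>s \<mapsto> G (\<tau> s) (g s)\<close> measurable for merely measurable \<open>g\<close>.
\<close>

lemma jointly_continuous:
  "continuous_on UNIV (\<lambda>p. G (fst p) (snd p))"
  unfolding continuous_on_def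
proof
  fix p :: "real \<times> 'a"
  have "((\<lambda>q. G (fst q) (snd q - snd p)) \<longlongrightarrow> 0) (at p)"
    by (rule Lim_null_comparison[of _ "\<lambda>q. norm (snd q - snd p)"])
      (auto simp: isometric simp del: linear_simps intro!: tendsto_eq_intros)
  moreover have "((\<lambda>q. G (fst q) (snd p)) \<longlongrightarrow> G (fst p) (snd p)) (at p)"
    by (rule continuous_on_tendsto_compose[OF continuous]) (auto intro!: tendsto_intros)
  ultimately have "((\<lambda>q. G (fst q) (snd q - snd p) + G (fst q) (snd p)) \<longlongrightarrow> 0 + G (fst p) (snd p)) (at p)"
    by (rule tendsto_add)
  then show "((\<lambda>p. G (fst p) (snd p)) \<longlongrightarrow> G (fst p) (snd p)) (at p within UNIV)" by simp
qed

lemma continuous_on_apply: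
  assumes "continuous_on I \<tau>" "continuous_on I g"
  shows "continuous_on I (\<lambda>s. G (\<tau> s) (g s))"
  using continuous_on_compose2[OF jointly_continuous continuous_on_Pair[OF assms]] by simp

lemma reversed: "unitary_group (\<lambda>t. G (- t))"
proof (rule unitary_group.intro)
  show "continuous_on UNIV (\<lambda>t. G (- t) x)" for x
    by (intro continuous_on_apply continuous_intros)
qed (simp_all only: linear isometric zero minus_zero minus_add_distrib add)

end

locale separable_unitary_group = unitary_group G
  for G :: "real \<Rightarrow> 'a::{real_inner,banach,second_countable_topology} \<Rightarrow> 'a"
begin

lemma set_integrable_apply:
  assumes g: "set_integrable lebesgue I g" and \<tau>: "continuous_on UNIV \<tau>"
  shows "set_integrable lebesgue I (\<lambda>s. G (\<tau> s) (g s))"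
proof -
  define k where "k s = indicator I s *\<^sub>R g s" for s
  have k: "integrable lebesgue k" using g by (simp add: set_integrable_def k_def[abs_def])
  have \<tau>m: "\<tau> \<in> borel_measurable lebesgue"
    using borel_measurable_continuous_onI[OF \<tau>] by (simp add: measurable_completion)
  have "(\<lambda>s. G (\<tau> s) (k s)) \<in> borel_measurable lebesgue"
    by (rule borel_measurable_continuous_Pair[OF \<tau>m _ jointly_continuous]) (use k in auto)
  with k have "integrable lebesgue (\<lambda>s. G (\<tau> s) (k s))"
    by (rule Bochner_Integration.integrable_bound) (simp add: isometric)
  then show ?thesis by (simp add: set_integrable_def k_def)
qed

text \<open>
  The group property lets \<open>G t\<close> leave the integral in the variation of constants formula. After pulling
  back, the solution is the indefinite integral of one integrable function; in particular it is
  continuous in \<open>t\<close>.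
\<close>

lemma mild_solution_pulled_back:
  assumes G: "\<And>t. t \<ge> 0 \<Longrightarrow> exp_semigroup D A t = G t"
    and mild: "is_mild_solution D A T g x z"
    and t: "t \<in> {0..T}"
  shows "set_integrable lebesgue {0..T} (\<lambda>s. G (- s) (g s))"
    and "G (- t) (z t) = x + (LINT s:{0..t}|lebesgue. G (- s) (g s))"
proof -
  have g: "set_integrable lebesgue {0..T} g" using mild by (simp add: is_mild_solution_def)
  show int: "set_integrable lebesgue {0..T} (\<lambda>s. G (- s) (g s))"
    by (rule set_integrable_apply[OF g]) (intro continuous_intros)
  have intt: "set_integrable lebesgue {0..t} (\<lambda>s. G (- s) (g s))"
    by (rule set_integrable_subset[OF int]) (use t in auto)
  have "z t = mild_sol D A g x t" using mild t by (simp add: is_mild_solution_def)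
  also have "\<dots> = G t x + (LINT s:{0..t}|lebesgue. exp_semigroup D A (t - s) (g s))"
    using t by (simp add: mild_sol_def G)
  also have "(LINT s:{0..t}|lebesgue. exp_semigroup D A (t - s) (g s)) = (LINT s:{0..t}|lebesgue. G t (G (- s) (g s)))"
    by (rule set_lebesgue_integral_cong) (auto simp: G add_apply)
  also have "\<dots> = G t (LINT s:{0..t}|lebesgue. G (- s) (g s))"
    by (rule set_integrable_bounded_linear(2)[OF linear intt])
  finally show "G (- t) (z t) = x + (LINT s:{0..t}|lebesgue. G (- s) (g s))"
    by simp
qed

end

section \<open>Error decay over half cycles\<close>

text \<open>
  Averaging for \<open>e' = \<kappa> (\<psi> - P e)\<close>. Let \<open>q = c T\<close> and \<open>\<Psi> = \<integral>\<parallel>\<psi>\<parallel>\<close>. For \<open>\<kappa> q \<le> 1/2\<close> the maximum of \<open>\<parallel>e\<parallel>\<close> can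
  be absorbed into the left-hand side, and \<open>\<parallel>e t - e 0\<parallel> \<le> \<kappa> (2 \<Psi> + 2 q \<parallel>e 0\<parallel>)\<close>. Replacing \<open>e\<close> by
  \<open>e 0\<close> under the integral thus costs \<open>O(\<kappa>\<^sup>2)\<close>, and \<open>\<psi>\<close> itself integrates to zero. The remaining step
  \<open>e 0 \<mapsto> e 0 - \<kappa> \<integral>P (e 0)\<close> contracts because the integral of \<open>P\<close> is bounded and coercive.
\<close>

lemma half_cycle_estimate:
  fixes e \<psi> :: "real \<Rightarrow> 'a::{real_inner,banach,second_countable_topology}"
    and P :: "real \<Rightarrow> 'a \<Rightarrow> 'a"
  assumes T: "T > 0"
    and \<psi>: "set_integrable lebesgue {0..T} \<psi>" and \<psi>0: "(LINT s:{0..T}|lebesgue. \<psi> s) = 0"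
    and lin: "\<And>s. bounded_linear (P s)"
    and c: "c \<ge> 0" "\<And>s x. norm (P s x) \<le> c * norm x"
    and P_int: "\<And>x. set_integrable lebesgue {0..T} (\<lambda>s. P s x)"
    and coercive: "\<And>x. \<delta> * (norm x)\<^sup>2 \<le> x \<bullet> (LINT s:{0..T}|lebesgue. P s x)"
    and Pe: "set_integrable lebesgue {0..T} (\<lambda>s. P s (e s))"
    and e: "\<And>t. t \<in> {0..T} \<Longrightarrow> e t = e 0 + \<kappa> *\<^sub>R (LINT s:{0..t}|lebesgue. \<psi> s - P s (e s))"
    and \<kappa>: "\<kappa> > 0" "\<kappa> * (c * T) \<le> 1 / 2" "\<kappa> * \<delta> \<le> 1"
  shows "norm (e T) \<le> (1 - \<kappa> * \<delta> + 3 * (c * T)\<^sup>2 * \<kappa>\<^sup>2) * norm (e 0)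
           + 2 * (c * T) * (LINT s:{0..T}|lebesgue. norm (\<psi> s)) * \<kappa>\<^sup>2"
proof -
  define q where "q = c * T"
  define \<Psi> where "\<Psi> = (LINT s:{0..T}|lebesgue. norm (\<psi> s))"
  have q: "q \<ge> 0" using c T by (simp add: q_def)
  have \<Psi>: "\<Psi> \<ge> 0" unfolding \<Psi>_def set_lebesgue_integral_def by (rule Bochner_Integration.integral_nonneg) auto
  have int: "set_integrable lebesgue {0..T} (\<lambda>s. \<psi> s - P s (e s))"
    by (rule set_integral_diff(1)[OF \<psi> Pe])
  have "continuous_on {0..T} (\<lambda>t. e 0 + \<kappa> *\<^sub>R (LINT s:{0..t}|lebesgue. \<psi> s - P s (e s)))"
    by (intro continuous_intros continuous_on_indefinite_integral[OF int])
  then have "continuous_on {0..T} e" by (rule continuous_on_eq) (rule e[symmetric])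
  then have "continuous_on {0..T} (\<lambda>t. norm (e t))" by (intro continuous_intros)
  then obtain t0 where t0: "t0 \<in> {0..T}" and max: "\<And>t. t \<in> {0..T} \<Longrightarrow> norm (e t) \<le> norm (e t0)"
    using continuous_attains_sup[of "{0..T}" "\<lambda>t. norm (e t)"] T by auto
  \<comment> \<open>The integral equation bounds the largest norm \<open>M\<close> in terms of \<open>M / 2\<close>, in place of Gronwall's inequality.\<close>
  define M where "M = norm (e t0)"
  have drift: "norm (e t - e 0) \<le> \<kappa> * (\<Psi> + q * M)" if t: "t \<in> {0..T}" for t
  proof -
    have int_t: "set_integrable lebesgue {0..t} (\<lambda>s. \<psi> s - P s (e s))"
      by (rule set_integrable_subset[OF int]) (use t in auto)
    have bnd: "set_integrable lebesgue {0..T} (\<lambda>s. norm (\<psi> s) + c * M)"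
      by (intro set_integral_add(1) set_integrable_norm \<psi> set_integrable_continuous_Icc continuous_intros)
    have "norm (LINT s:{0..t}|lebesgue. \<psi> s - P s (e s)) \<le> (LINT s:{0..t}|lebesgue. norm (\<psi> s - P s (e s)))"
      by (rule set_integral_norm_le[OF int_t])
    also have "\<dots> \<le> (LINT s:{0..T}|lebesgue. norm (\<psi> s) + c * M)"
      unfolding set_lebesgue_integral_def
    proof (rule integral_mono)
      show "integrable lebesgue (\<lambda>s. indicator {0..t} s *\<^sub>R norm (\<psi> s - P s (e s)))"
        using set_integrable_norm[OF int_t] by (simp add: set_integrable_def)
      show "integrable lebesgue (\<lambda>s. indicator {0..T} s *\<^sub>R (norm (\<psi> s) + c * M))"
        using bnd by (simp add: set_integrable_def)
      have "norm (\<psi> s - P s (e s)) \<le> norm (\<psi> s) + c * M" if "s \<in> {0..T}" for s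
        using norm_triangle_ineq4[of "\<psi> s" "P s (e s)"] c(2)[of s "e s"] mult_left_mono[OF max[OF that] c(1)]
        by (simp add: M_def)
      moreover have "0 \<le> norm (\<psi> s) + c * M" for s using c by (simp add: M_def)
      ultimately show "indicator {0..t} s *\<^sub>R norm (\<psi> s - P s (e s)) \<le> indicator {0..T} s *\<^sub>R (norm (\<psi> s) + c * M)" for s
        using t by (auto simp: indicator_def)
    qed
    also have "\<dots> = \<Psi> + (LINT s:{0..T}|lebesgue. c * M)"
      unfolding \<Psi>_def
      by (intro set_integral_add(2) set_integrable_norm \<psi> set_integrable_continuous_Icc continuous_intros)
    also have "(LINT s:{0..T}|lebesgue. c * M) = q * M"
      using T by (simp add: set_lebesgue_integral_def q_def)
    finally show ?thesis using e[OF t] \<kappa> by simp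
  qed
  define R where "R = 2 * \<Psi> + 2 * q * norm (e 0)"
  have "M \<le> norm (e 0) + \<kappa> * (\<Psi> + q * M)"
    using drift[OF t0] norm_triangle_sub[of "e t0" "e 0"] by (simp add: M_def)
  moreover have "\<kappa> * q * M \<le> M / 2"
    using mult_right_mono[OF \<kappa>(2), of M] by (simp add: q_def M_def)
  ultimately have M: "M \<le> 2 * norm (e 0) + 2 * (\<kappa> * \<Psi>)" by (simp add: algebra_simps)
  have "q * M \<le> q * (2 * norm (e 0) + 2 * (\<kappa> * \<Psi>))" by (rule mult_left_mono[OF M q])
  also have "\<dots> \<le> 2 * q * norm (e 0) + \<Psi>"
    using mult_right_mono[OF \<kappa>(2) \<Psi>] by (simp add: q_def algebra_simps)
  finally have "\<Psi> + q * M \<le> R" by (simp add: R_def)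
  then have drift': "norm (e t - e 0) \<le> \<kappa> * R" if "t \<in> {0..T}" for t
    using drift[OF that] mult_left_mono[of "\<Psi> + q * M" R \<kappa>] \<kappa> by linarith
  define Q where "Q = (LINT s:{0..T}|lebesgue. P s (e 0))"
  define N where "N = (LINT s:{0..T}|lebesgue. P s (e s) - P s (e 0))"
  have N: "norm N \<le> q * (\<kappa> * R)"
  proof -
    have "norm (P s (e s) - P s (e 0)) \<le> c * (\<kappa> * R)" if "s \<in> {0..T}" for s
    proof -
      have "P s (e s) - P s (e 0) = P s (e s - e 0)"
        by (simp add: linear_diff[OF bounded_linear.linear[OF lin]])
      then show ?thesis using c(2)[of s "e s - e 0"] mult_left_mono[OF drift'[OF that] c(1)] by simp
    qed
    from set_integral_norm_le_const[OF set_integral_diff(1)[OF Pe P_int] _ this]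
    show ?thesis using T by (simp add: N_def q_def mult_ac)
  qed
  have Q: "norm Q \<le> q * norm (e 0)"
    using set_integral_norm_le_const[OF P_int[of "e 0"], where b = "c * norm (e 0)"] c T by (simp add: Q_def q_def mult_ac)
  have split: "e T = (e 0 - \<kappa> *\<^sub>R Q) - \<kappa> *\<^sub>R N"
  proof -
    have "(LINT s:{0..T}|lebesgue. \<psi> s - P s (e s)) = - (LINT s:{0..T}|lebesgue. P s (e s))"
      using set_integral_diff(2)[OF \<psi> Pe] \<psi>0 by simp
    moreover have "N = (LINT s:{0..T}|lebesgue. P s (e s)) - Q"
      unfolding N_def Q_def by (rule set_integral_diff(2)[OF Pe P_int])
    ultimately have "(LINT s:{0..T}|lebesgue. \<psi> s - P s (e s)) = - (N + Q)" by simp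
    then show ?thesis using e[of T] T by (simp add: scaleR_diff_right)
  qed
  have main: "norm (e 0 - \<kappa> *\<^sub>R Q) \<le> (1 - \<kappa> * \<delta> + (\<kappa> * q)\<^sup>2) * norm (e 0)"
  proof (rule power2_le_imp_le)
    have "(norm (e 0 - \<kappa> *\<^sub>R Q))\<^sup>2 = (norm (e 0))\<^sup>2 - 2 * \<kappa> * (e 0 \<bullet> Q) + \<kappa>\<^sup>2 * (norm Q)\<^sup>2"
      unfolding power2_norm_eq_inner by (simp add: inner_diff_left inner_diff_right inner_commute power2_eq_square)
    also have "\<dots> \<le> (norm (e 0))\<^sup>2 - 2 * \<kappa> * (\<delta> * (norm (e 0))\<^sup>2) + \<kappa>\<^sup>2 * (q * norm (e 0))\<^sup>2"
      using \<kappa> coercive[of "e 0"]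
      by (intro add_mono diff_mono mult_left_mono power_mono Q) (auto simp: Q_def)
    also have "\<dots> = (1 - 2 * (\<kappa> * \<delta>) + (\<kappa> * q)\<^sup>2) * (norm (e 0))\<^sup>2"
      by (simp add: algebra_simps power_mult_distrib)
    also have "\<dots> \<le> (1 - \<kappa> * \<delta> + (\<kappa> * q)\<^sup>2)\<^sup>2 * (norm (e 0))\<^sup>2"
    proof (rule mult_right_mono)
      define u v where "u = \<kappa> * \<delta>" and "v = (\<kappa> * q)\<^sup>2"
      \<comment> \<open>The contraction factor \<open>1 - u + v\<close> comes from this comparison of squares.\<close>
      have "(1 - u + v)\<^sup>2 = 1 - 2 * u + v + (u - v)\<^sup>2 + v" by (simp add: power2_eq_square algebra_simps)
      moreover have "v \<ge> 0" by (simp add: v_def)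
      ultimately have "1 - 2 * u + v \<le> (1 - u + v)\<^sup>2" by simp
      then show "1 - 2 * (\<kappa> * \<delta>) + (\<kappa> * q)\<^sup>2 \<le> (1 - \<kappa> * \<delta> + (\<kappa> * q)\<^sup>2)\<^sup>2" by (simp add: u_def v_def)
    qed simp
    finally show "(norm (e 0 - \<kappa> *\<^sub>R Q))\<^sup>2 \<le> ((1 - \<kappa> * \<delta> + (\<kappa> * q)\<^sup>2) * norm (e 0))\<^sup>2"
      by (simp add: power_mult_distrib)
    show "0 \<le> (1 - \<kappa> * \<delta> + (\<kappa> * q)\<^sup>2) * norm (e 0)" using \<kappa>(3) by simp
  qed
  have "norm (e T) \<le> norm (e 0 - \<kappa> *\<^sub>R Q) + \<kappa> * norm N"
    using norm_triangle_ineq4[of "e 0 - \<kappa> *\<^sub>R Q" "\<kappa> *\<^sub>R N"] \<kappa> by (simp add: split)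
  also have "\<dots> \<le> (1 - \<kappa> * \<delta> + (\<kappa> * q)\<^sup>2) * norm (e 0) + \<kappa> * (q * (\<kappa> * R))"
    using main N \<kappa> by (intro add_mono mult_left_mono) auto
  also have "\<dots> = (1 - \<kappa> * \<delta> + 3 * q\<^sup>2 * \<kappa>\<^sup>2) * norm (e 0) + 2 * q * \<Psi> * \<kappa>\<^sup>2"
    by (simp add: R_def algebra_simps power2_eq_square)
  finally show ?thesis by (simp add: q_def \<Psi>_def)
qed

text \<open>
  Adding to \<open>a j\<close> the remaining perturbation \<open>r j = K \<Sum>\<^bsub>i \<ge> j\<^esub> \<kappa>\<^sub>i\<^sup>2\<close> gives a sequence that eventually decreases
  by at least \<open>\<beta> \<kappa>\<^sub>j a\<^sub>j\<close> in each step, so \<open>a\<close> converges. A positive limit is impossible, since then the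
  total decrease would be infinite like \<open>\<Sum> \<kappa>\<^sub>j\<close>.
\<close>

lemma contraction_recursion_tendsto_0:
  fixes a \<kappa> :: "nat \<Rightarrow> real"
  assumes a: "\<And>j. a j \<ge> 0" and \<kappa>: "\<And>j. j \<ge> 1 \<Longrightarrow> \<kappa> j > 0"
    and div: "filterlim (\<lambda>n. \<Sum>j=1..n. \<kappa> j) at_top sequentially"
    and sq: "summable (\<lambda>j. (\<kappa> j)\<^sup>2)" and \<beta>: "\<beta> > 0" and K: "K \<ge> 0"
    and rec: "\<forall>\<^sub>F j in sequentially. a (Suc j) \<le> (1 - \<beta> * \<kappa> j) * a j + K * (\<kappa> j)\<^sup>2"
  shows "a \<longlonglongrightarrow> 0"
proof -
  obtain N where N: "N \<ge> 1" and recN: "\<And>j. j \<ge> N \<Longrightarrow> a (Suc j) \<le> (1 - \<beta> * \<kappa> j) * a j + K * (\<kappa> j)\<^sup>2"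
    using rec unfolding eventually_sequentially by (metis max.bounded_iff max.cobounded1 order.trans nat_le_linear)
  define r where "r j = K * (\<Sum>i. (\<kappa> (i + j))\<^sup>2)" for j
  have r_Suc: "r j = K * (\<kappa> j)\<^sup>2 + r (Suc j)" for j
    using suminf_split_head[of "\<lambda>i. (\<kappa> (i + j))\<^sup>2"] summable_ignore_initial_segment[OF sq, of j]
    by (simp add: r_def flip: distrib_left)
  have r0: "r j \<ge> 0" for j
    using summable_ignore_initial_segment[OF sq, of j] K
    by (auto simp: r_def intro!: mult_nonneg_nonneg suminf_nonneg)
  have "(\<lambda>j. \<Sum>i. (\<kappa> (i + j))\<^sup>2) \<longlonglongrightarrow> 0"
    using suminf_exist_split2[OF sq] by simp
  then have r_lim: "r \<longlonglongrightarrow> 0" unfolding r_def by (rule tendsto_mult_right_zero)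
  define u where "u j = a (j + N) + r (j + N)" for j
  have step: "u (Suc j) \<le> u j - \<beta> * \<kappa> (j + N) * a (j + N)" for j
    using recN[of "j + N"] r_Suc[of "j + N"] by (simp add: u_def algebra_simps)
  have u0: "u j \<ge> 0" for j using a r0 by (simp add: u_def)
  have "decseq u"
  proof (rule decseq_SucI)
    show "u (Suc j) \<le> u j" for j
    proof -
      have "0 \<le> \<beta> * \<kappa> (j + N) * a (j + N)" using \<beta> \<kappa>[of "j + N"] N a by simp
      then show ?thesis using step[of j] by linarith
    qed
  qed
  then obtain L where L: "u \<longlonglongrightarrow> L" using decseq_convergent[of u 0] u0 by blast
  have L0: "L \<ge> 0" using LIMSEQ_le_const[OF L] u0 by blast
  have "(\<lambda>j. u j - r (j + N)) \<longlonglongrightarrow> L - 0"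
    by (intro tendsto_diff L LIMSEQ_ignore_initial_segment r_lim)
  then have aL: "(\<lambda>j. a (j + N)) \<longlonglongrightarrow> L" by (simp add: u_def)
  have "L = 0"
  proof (rule ccontr)
    assume "L \<noteq> 0"
    then have "L > L / 2" "L / 2 > 0" using L0 by auto
    then obtain M where M: "\<And>j. j \<ge> M \<Longrightarrow> a (j + N) > L / 2"
      using order_tendstoD(1)[OF aL, of "L / 2"] by (auto simp: eventually_sequentially)
    define b where "b = \<beta> * (L / 2)"
    have b: "b > 0" using \<beta> \<open>L / 2 > 0\<close> by (simp add: b_def)
    have sum: "b * (\<Sum>j=1..n + M + N. \<kappa> j) \<le> b * (\<Sum>j=1..M + N. \<kappa> j) + u (Suc M) - u (Suc (n + M))" for n
    proof (induction n)
      case (Suc n)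
      have "b * \<kappa> (Suc n + M + N) \<le> \<beta> * \<kappa> (Suc n + M + N) * a (Suc n + M + N)"
        using M[of "Suc n + M"] \<beta> \<kappa>[of "Suc n + M + N"] by (simp add: b_def mult_ac)
      also have "\<dots> \<le> u (Suc (n + M)) - u (Suc (Suc n + M))"
        using step[of "Suc n + M"] by simp
      finally show ?case using Suc.IH by (simp add: algebra_simps)
    qed simp
    have "\<forall>\<^sub>F n in sequentially. (\<Sum>j=1..n. \<kappa> j) > (\<Sum>j=1..M + N. \<kappa> j) + u (Suc M) / b"
      using div by (simp add: filterlim_at_top_dense)
    then obtain n0 where "\<And>n. n \<ge> n0 \<Longrightarrow> (\<Sum>j=1..n. \<kappa> j) > (\<Sum>j=1..M + N. \<kappa> j) + u (Suc M) / b"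
      by (auto simp: eventually_sequentially)
    from this[of "n0 + M + N"] have "b * ((\<Sum>j=1..M + N. \<kappa> j) + u (Suc M) / b) < b * (\<Sum>j=1..n0 + M + N. \<kappa> j)"
      using b by (intro mult_strict_left_mono) auto
    then have "b * (\<Sum>j=1..M + N. \<kappa> j) + u (Suc M) < b * (\<Sum>j=1..n0 + M + N. \<kappa> j)"
      using b by (simp add: algebra_simps)
    then show False using sum[of n0] u0[of "Suc (n0 + M)"] by linarith
  qed
  then show ?thesis using aL LIMSEQ_offset[of a N 0] by simp
qed

section \<open>The normal equation and the observer errors\<close>

locale observed_unitary_group = separable_unitary_group G
  for G :: "real \<Rightarrow> 'a::{real_inner,banach,second_countable_topology} \<Rightarrow> 'a" +
  fixes C :: "'a \<Rightarrow> 'b::{real_inner,banach,second_countable_topology}"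
    and T \<delta> :: real
  assumes T: "T > 0" and C: "bounded_linear C" and \<delta>: "\<delta> > 0"
    and observability: "\<delta> * (norm x)\<^sup>2 \<le> (LINT t:{0..T}|lebesgue. (norm (C (G t x)))\<^sup>2)"
begin

text \<open>
  The integrand of the observability Gramian.
\<close>

definition gram :: "real \<Rightarrow> 'a \<Rightarrow> 'a" where
  "gram s x = G (- s) (adjoint C (C (G s x)))"

definition gram_bound :: real where
  "gram_bound = onorm (adjoint C) * onorm C"

text \<open>
  The free solution \<open>z[x]\<close> is \<open>G t (x + pulled_load f t)\<close>.
\<close>

definition pulled_load :: "(real \<Rightarrow> 'a) \<Rightarrow> real \<Rightarrow> 'a" where
  "pulled_load f t = (LINT s:{0..t}|lebesgue. G (- s) (f s))"

text \<open>
  The gradient of the cost at \<open>x\<close> is minus the integral of \<open>residual f y x\<close> over \<open>[0,T]\<close>.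
\<close>

definition residual :: "(real \<Rightarrow> 'a) \<Rightarrow> (real \<Rightarrow> 'b) \<Rightarrow> 'a \<Rightarrow> real \<Rightarrow> 'a" where
  "residual f y x s = G (- s) (adjoint C (y s - C (G s (x + pulled_load f s))))"

lemma C_adjoint: "bounded_linear (adjoint C)" "C x \<bullet> w = x \<bullet> adjoint C w"
  by (rule bounded_linear_adjoint[OF C], rule hilbert_adjoint[OF C])

lemma continuous_on_C: "continuous_on I g \<Longrightarrow> continuous_on I (\<lambda>s. C (g s))"
  by (rule bounded_linear.continuous_on[OF C])

lemma continuous_on_gram: "continuous_on I \<tau> \<Longrightarrow> continuous_on I g \<Longrightarrow> continuous_on I (\<lambda>s. gram (\<tau> s) (g s))"
  unfolding gram_def
  by (intro continuous_on_apply continuous_on_minus bounded_linear.continuous_on[OF C_adjoint(1)] continuous_on_C)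

lemma bounded_linear_gram: "bounded_linear (gram s)"
  unfolding gram_def
  by (rule bounded_linear_compose[OF linear bounded_linear_compose[OF C_adjoint(1) bounded_linear_compose[OF C linear]]])

lemma norm_gram_le: "norm (gram s x) \<le> gram_bound * norm x"
proof -
  have "norm (gram s x) \<le> onorm (adjoint C) * norm (C (G s x))"
    unfolding gram_def isometric by (rule onorm[OF C_adjoint(1)])
  also have "\<dots> \<le> onorm (adjoint C) * (onorm C * norm (G s x))"
    by (intro mult_left_mono onorm C onorm_pos_le C_adjoint(1))
  finally show ?thesis by (simp add: gram_bound_def isometric mult.assoc)
qed

lemma gram_bound_nonneg: "gram_bound \<ge> 0"
  unfolding gram_bound_def by (intro mult_nonneg_nonneg onorm_pos_le C C_adjoint(1))

lemma gram_inner: "gram s x \<bullet> h = C (G s x) \<bullet> C (G s h)"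
  using adjoint_eq[of "- s" "adjoint C (C (G s x))" h]
  by (simp add: gram_def C_adjoint(2) inner_commute)

lemma set_integrable_gram: "set_integrable lebesgue {0..T} (\<lambda>s. gram s x)"
  by (intro set_integrable_continuous_Icc continuous_on_gram continuous_intros)

lemma gram_coercive: "\<delta> * (norm x)\<^sup>2 \<le> (LINT s:{0..T}|lebesgue. gram s x) \<bullet> x"
  using observability[of x]
  by (simp add: set_integral_inner(2)[OF set_integrable_gram, symmetric] gram_inner power2_norm_eq_inner)

text \<open>
  The Gramian \<open>\<integral>\<^sub>0\<^sup>T gram s ds\<close> is bounded, symmetric and, by observability, coercive.
\<close>

lemma gramian_surjective:
  obtains x where "(LINT s:{0..T}|lebesgue. gram s x) = v"
proof -
  define W where "W x = (LINT s:{0..T}|lebesgue. gram s x)" for x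
  have W_inner: "W x \<bullet> h = (LINT s:{0..T}|lebesgue. C (G s x) \<bullet> C (G s h))" for x h
    unfolding W_def set_integral_inner(2)[OF set_integrable_gram, symmetric] by (simp add: gram_inner)
  have "bounded_linear W"
  proof (rule bounded_linear_intro)
    fix x y r
    show "W (x + y) = W x + W y"
      using set_integral_add(2)[OF set_integrable_gram set_integrable_gram]
      by (simp add: W_def linear_add[OF bounded_linear.linear[OF bounded_linear_gram]])
    show "W (r *\<^sub>R x) = r *\<^sub>R W x"
      by (simp add: W_def linear_scale[OF bounded_linear.linear[OF bounded_linear_gram]])
    show "norm (W x) \<le> norm x * (gram_bound * T)"
      using set_integral_norm_le_const[OF set_integrable_gram _ norm_gram_le, of x] T
      by (simp add: W_def mult_ac)
  qed
  then have "bounded_bilinear (\<lambda>x h. W x \<bullet> h)"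
    by (rule bounded_bilinear.comp1[OF bounded_bilinear_inner])
  moreover have "W x \<bullet> h = W h \<bullet> x" for x h by (simp only: W_inner) (simp only: inner_commute)
  moreover have "\<delta> * (norm x)\<^sup>2 \<le> W x \<bullet> x" for x unfolding W_def by (rule gram_coercive)
  ultimately obtain x where x: "\<And>h. W x \<bullet> h = v \<bullet> h"
    using symmetric_Lax_Milgram[OF _ _ \<delta> _ bounded_linear_inner_right, of "\<lambda>x h. W x \<bullet> h" v] by blast
  have "W x = v" by (rule inner_left_eqI) (metis x inner_commute)
  then show ?thesis using that by (simp add: W_def)
qed

context
  fixes f :: "real \<Rightarrow> 'a" and y :: "real \<Rightarrow> 'b"
  assumes f: "set_integrable lebesgue {0..T} f" and y: "L2_on {0..T} y"
begin

lemma set_integrable_pulled_load: "set_integrable lebesgue {0..T} (\<lambda>s. G (- s) (f s))"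
  by (rule set_integrable_apply[OF f]) (intro continuous_intros)

lemma continuous_on_pulled_load: "continuous_on {0..T} (pulled_load f)"
  unfolding pulled_load_def by (rule continuous_on_indefinite_integral[OF set_integrable_pulled_load])

lemma pulled_load_0: "pulled_load f 0 = 0"
  by (simp add: pulled_load_def set_integral_singleton)

lemma continuous_on_free_output: "continuous_on {0..T} (\<lambda>s. C (G s (x + pulled_load f s)))"
  by (intro continuous_on_C continuous_on_apply continuous_intros continuous_on_pulled_load)

lemma set_integrable_output_residual:
  "set_integrable lebesgue {0..T} (\<lambda>s. y s - C (G s (x + pulled_load f s)))"
  by (intro set_integral_diff(1) L2_on_integrable[OF y] set_integrable_continuous_Icc continuous_on_free_output)

lemma set_integrable_residual: "set_integrable lebesgue {0..T} (residual f y x)"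
  unfolding residual_def
  by (intro set_integrable_apply set_integrable_bounded_linear(1)[OF C_adjoint(1)]
      set_integrable_output_residual continuous_intros)

text \<open>
  With \<open>e\<close> the pulled back error, \<open>G s (e + x + pulled_load f s)\<close> is the observer state itself. This
  identity turns the output feedback into the right-hand side of the error equation.
\<close>

lemma residual_diff: "residual f y x s - gram s e = G (- s) (adjoint C (y s - C (G s (e + x + pulled_load f s))))"
  by (simp add: residual_def gram_def linear_diff[OF bounded_linear.linear[OF C_adjoint(1)]]
      linear_add[OF bounded_linear.linear[OF C_adjoint(1)]] linear_add[OF bounded_linear.linear[OF C]])

lemma normal_equation:
  obtains x where "(LINT s:{0..T}|lebesgue. residual f y x s) = 0"
proof -
  obtain x where x: "(LINT s:{0..T}|lebesgue. gram s x) = (LINT s:{0..T}|lebesgue. residual f y 0 s)"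
    by (rule gramian_surjective)
  have "residual f y x s = residual f y 0 s - gram s x" for s
    by (simp add: residual_diff) (simp add: residual_def)
  then have "(LINT s:{0..T}|lebesgue. residual f y x s) = 0"
    using set_integral_diff(2)[OF set_integrable_residual[of 0] set_integrable_gram[of x]] x by simp
  then show ?thesis by (rule that)
qed

definition misfit :: "'a \<Rightarrow> real" where
  "misfit x = 1 / 2 * (LINT s:{0..T}|lebesgue. (norm (y s - C (G s (x + pulled_load f s))))\<^sup>2)"

lemma set_integrable_misfit:
  "set_integrable lebesgue {0..T} (\<lambda>s. (norm (y s - C (G s (x + pulled_load f s))))\<^sup>2)"
proof (rule set_integrable_bound)
  let ?w = "\<lambda>s. C (G s (x + pulled_load f s))"
  show "set_integrable lebesgue {0..T} (\<lambda>s. 2 * (norm (y s))\<^sup>2 + 2 * (norm (?w s))\<^sup>2)"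
  proof -
    have y2: "set_integrable lebesgue {0..T} (\<lambda>s. (norm (y s))\<^sup>2)" using y by (simp add: L2_on_def)
    show ?thesis
      by (intro y2 set_integral_add(1) set_integrable_mult_right set_integrable_continuous_Icc
          continuous_intros continuous_on_free_output)
  qed
  have "(\<lambda>s. indicator {0..T} s *\<^sub>R (y s - ?w s)) \<in> borel_measurable lebesgue"
    using set_integrable_output_residual[of x] by (auto simp: set_integrable_def)
  then have "(\<lambda>s. (norm (indicator {0..T} s *\<^sub>R (y s - ?w s)))\<^sup>2) \<in> borel_measurable lebesgue" by measurable
  moreover have "(norm (indicator {0..T} s *\<^sub>R (y s - ?w s)))\<^sup>2 = indicator {0..T} s *\<^sub>R (norm (y s - ?w s))\<^sup>2" for s
    by (simp add: indicator_def)
  ultimately show "set_borel_measurable lebesgue {0..T} (\<lambda>s. (norm (y s - ?w s))\<^sup>2)"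
    by (simp add: set_borel_measurable_def)
  have "(norm (a - b))\<^sup>2 \<le> 2 * (norm a)\<^sup>2 + 2 * (norm b)\<^sup>2" for a b :: 'b
  proof -
    have "2 * (norm a)\<^sup>2 + 2 * (norm b)\<^sup>2 - (norm (a - b))\<^sup>2 = (norm (a + b))\<^sup>2"
      by (simp add: power2_norm_eq_inner inner_add_left inner_add_right inner_diff_left inner_diff_right inner_commute)
    then show ?thesis by (metis diff_ge_0_iff_ge zero_le_power2)
  qed
  then show "AE s in lebesgue. s \<in> {0..T} \<longrightarrow>
      norm ((norm (y s - ?w s))\<^sup>2) \<le> norm (2 * (norm (y s))\<^sup>2 + 2 * (norm (?w s))\<^sup>2)"
    by (auto intro!: AE_I2)
qed

text \<open>
  The cross term of the square is \<open>(\<integral>residual) \<bullet> h\<close>, which the normal equation removes.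
\<close>

lemma misfit_expansion:
  assumes x: "(LINT s:{0..T}|lebesgue. residual f y x s) = 0"
  shows "misfit (x + h) = misfit x + 1 / 2 * (LINT s:{0..T}|lebesgue. (norm (C (G s h)))\<^sup>2)"
proof -
  let ?r = "\<lambda>s. y s - C (G s (x + pulled_load f s))"
  have res: "?r s \<bullet> C (G s h) = residual f y x s \<bullet> h" for s
    using adjoint_eq[of "- s" "adjoint C (?r s)" h]
    by (simp add: residual_def C_adjoint(2) inner_commute)
  have "(norm (y s - C (G s (x + h + pulled_load f s))))\<^sup>2
      = ((norm (?r s))\<^sup>2 - 2 * (residual f y x s \<bullet> h)) + (norm (C (G s h)))\<^sup>2" for s
  proof -
    have "y s - C (G s (x + h + pulled_load f s)) = ?r s - C (G s h)"
      by (simp add: linear_add[OF bounded_linear.linear[OF C]])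
    moreover have "(norm (a - b))\<^sup>2 = (norm a)\<^sup>2 - 2 * (a \<bullet> b) + (norm b)\<^sup>2" for a b :: 'b
      by (simp add: power2_norm_eq_inner inner_diff_left inner_diff_right inner_commute)
    ultimately show ?thesis by (simp only: res)
  qed
  then have "misfit (x + h) = 1 / 2 * (LINT s:{0..T}|lebesgue.
      ((norm (?r s))\<^sup>2 - 2 * (residual f y x s \<bullet> h)) + (norm (C (G s h)))\<^sup>2)"
    by (simp add: misfit_def)
  also have "(LINT s:{0..T}|lebesgue. ((norm (?r s))\<^sup>2 - 2 * (residual f y x s \<bullet> h)) + (norm (C (G s h)))\<^sup>2)
      = (LINT s:{0..T}|lebesgue. (norm (?r s))\<^sup>2) - 2 * ((LINT s:{0..T}|lebesgue. residual f y x s) \<bullet> h)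
        + (LINT s:{0..T}|lebesgue. (norm (C (G s h)))\<^sup>2)"
  proof -
    note i1 = set_integrable_misfit[of x]
    note i2 = set_integrable_mult_right[OF set_integral_inner(1)[OF set_integrable_residual[of x], of h], of 2]
    have i3: "set_integrable lebesgue {0..T} (\<lambda>s. (norm (C (G s h)))\<^sup>2)"
      by (intro set_integrable_continuous_Icc continuous_intros continuous_on_C continuous_on_apply)
    show ?thesis
      by (simp only: set_integral_add(2)[OF set_integral_diff(1)[OF i1 i2] i3] set_integral_diff(2)[OF i1 i2]
          set_integral_mult_right set_integral_inner(2)[OF set_integrable_residual])
  qed
  finally show ?thesis using x by (simp add: misfit_def)
qed

lemma unique_minimizer:
  assumes x: "(LINT s:{0..T}|lebesgue. residual f y x s) = 0"
  shows "is_arg_min misfit (\<lambda>_. True) z \<longleftrightarrow> z = x"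
proof -
  have grow: "misfit z \<ge> misfit x + \<delta> / 2 * (norm (z - x))\<^sup>2" for z
    using misfit_expansion[OF x, of "z - x"] observability[of "z - x"] by simp
  have "misfit x \<le> misfit z" for z
    using grow[of z] \<delta> by (smt (verit) mult_nonneg_nonneg zero_le_power2 divide_nonneg_pos)
  moreover have "misfit x < misfit z" if "z \<noteq> x" for z
  proof -
    have "\<delta> / 2 * (norm (z - x))\<^sup>2 > 0" using \<delta> that by simp
    then show ?thesis using grow[of z] by linarith
  qed
  ultimately show ?thesis unfolding is_arg_min_def by (metis not_le)
qed

text \<open>
  The coefficient of \<open>\<kappa>\<^sup>2\<close> that \<open>half_cycle_estimate\<close> attaches to the unexplained part of the
  measurement.
\<close>

definition cycle_noise :: "'a \<Rightarrow> real" where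
  "cycle_noise x = 2 * (gram_bound * T) * (LINT s:{0..T}|lebesgue. norm (residual f y x s))"

text \<open>
  The pulled back error of a forward observer starts at \<open>z0 - x\<close> and ends at the point at which the
  error of the following backward observer starts.
\<close>

lemma forward_half_cycle:
  assumes x: "(LINT s:{0..T}|lebesgue. residual f y x s) = 0"
    and G: "\<And>t. t \<ge> 0 \<Longrightarrow> exp_semigroup D A t = G t"
    and z: "is_mild_solution D A T (\<lambda>t. f t + \<kappa> *\<^sub>R adjoint C (y t - C (z t))) z0 z"
    and \<kappa>: "\<kappa> > 0" "\<kappa> * (gram_bound * T) \<le> 1 / 2" "\<kappa> * \<delta> \<le> 1"
  shows "norm (G (- T) (z T) - pulled_load f T - x)
    \<le> (1 - \<kappa> * \<delta> + 3 * (gram_bound * T)\<^sup>2 * \<kappa>\<^sup>2) * norm (z0 - x) + cycle_noise x * \<kappa>\<^sup>2"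
proof -
  define e where "e t = G (- t) (z t) - pulled_load f t - x" for t
  define g where "g s = f s + \<kappa> *\<^sub>R adjoint C (y s - C (z s))" for s
  have pb: "set_integrable lebesgue {0..T} (\<lambda>s. G (- s) (g s))"
    "G (- t) (z t) = z0 + (LINT s:{0..t}|lebesgue. G (- s) (g s))" if t: "t \<in> {0..T}" for t
    using mild_solution_pulled_back[OF G z t] by (simp_all add: g_def)
  have int: "set_integrable lebesgue {0..T} (\<lambda>s. G (- s) (g s))" by (rule pb(1)[of 0]) (use T in auto)
  have "continuous_on {0..T} (\<lambda>t. z0 + (LINT s:{0..t}|lebesgue. G (- s) (g s)) - pulled_load f t - x)"
    by (intro continuous_intros continuous_on_indefinite_integral[OF int] continuous_on_pulled_load)
  then have e_cont: "continuous_on {0..T} e"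
    by (rule continuous_on_eq) (simp add: e_def pb(2))
  have gram_e: "set_integrable lebesgue {0..T} (\<lambda>s. gram s (e s))"
    by (intro set_integrable_continuous_Icc continuous_on_gram e_cont continuous_intros)
  have e0: "e 0 = z0 - x"
    using pb(2)[of 0] T by (simp add: e_def pulled_load_0 zero set_integral_singleton)
  have e_eq: "e t = e 0 + \<kappa> *\<^sub>R (LINT s:{0..t}|lebesgue. residual f y x s - gram s (e s))" if t: "t \<in> {0..T}" for t
  proof -
    have sub: "set_integrable lebesgue {0..t} k" if "set_integrable lebesgue {0..T} k" for k :: "real \<Rightarrow> 'a"
      by (rule set_integrable_subset[OF that]) (use t in auto)
    have "(LINT s:{0..t}|lebesgue. G (- s) (g s))
        = (LINT s:{0..t}|lebesgue. G (- s) (f s) + \<kappa> *\<^sub>R (residual f y x s - gram s (e s)))"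
    proof (rule set_lebesgue_integral_cong)
      have "G s (e s + x + pulled_load f s) = z s" for s by (simp add: e_def)
      then show "\<forall>s. s \<in> {0..t} \<longrightarrow> G (- s) (g s) = G (- s) (f s) + \<kappa> *\<^sub>R (residual f y x s - gram s (e s))"
        by (simp only: residual_diff) (simp add: g_def)
    qed simp
    also have "\<dots> = pulled_load f t + \<kappa> *\<^sub>R (LINT s:{0..t}|lebesgue. residual f y x s - gram s (e s))"
      by (simp add: pulled_load_def sub set_integrable_pulled_load set_integrable_residual gram_e)
    finally show ?thesis using pb(2)[OF t] by (simp add: e0) (simp add: e_def)
  qed
  have "norm (e T) \<le> (1 - \<kappa> * \<delta> + 3 * (gram_bound * T)\<^sup>2 * \<kappa>\<^sup>2) * norm (e 0)
      + 2 * (gram_bound * T) * (LINT s:{0..T}|lebesgue. norm (residual f y x s)) * \<kappa>\<^sup>2"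
    by (rule half_cycle_estimate[OF T set_integrable_residual x bounded_linear_gram gram_bound_nonneg
          norm_gram_le set_integrable_gram _ gram_e e_eq \<kappa>])
      (simp_all add: gram_coercive inner_commute[of _ "set_lebesgue_integral _ _ _"])
  then show ?thesis by (simp add: e0 cycle_noise_def) (simp add: e_def)
qed

text \<open>
  The same estimate with time reversed: the error is pulled back from the physical time \<open>T - t\<close>, so
  residual and Gramian run from \<open>T\<close> down to \<open>0\<close>. Their integrals over \<open>[0,T]\<close> are unchanged by the
  reflection, and the load, entering with the opposite sign, unwinds \<open>pulled_load f T\<close>.
\<close>

lemma backward_half_cycle:
  assumes x: "(LINT s:{0..T}|lebesgue. residual f y x s) = 0"
    and G: "\<And>t. t \<ge> 0 \<Longrightarrow> exp_semigroup D A t = G (- t)"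
    and z: "is_mild_solution D A T (\<lambda>t. - f (T - t) + \<kappa> *\<^sub>R adjoint C (y (T - t) - C (z t))) z0 z"
    and \<kappa>: "\<kappa> > 0" "\<kappa> * (gram_bound * T) \<le> 1 / 2" "\<kappa> * \<delta> \<le> 1"
  shows "norm (z T - x)
    \<le> (1 - \<kappa> * \<delta> + 3 * (gram_bound * T)\<^sup>2 * \<kappa>\<^sup>2) * norm (G (- T) z0 - pulled_load f T - x) + cycle_noise x * \<kappa>\<^sup>2"
proof -
  define e where "e t = G (- (T - t)) (z t) - pulled_load f (T - t) - x" for t
  define g where "g s = - f (T - s) + \<kappa> *\<^sub>R adjoint C (y (T - s) - C (z s))" for s
  interpret R: separable_unitary_group "\<lambda>t. G (- t)"
    by (rule separable_unitary_group.intro[OF reversed])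
  have pb: "set_integrable lebesgue {0..T} (\<lambda>s. G s (g s))"
    "G t (z t) = z0 + (LINT s:{0..t}|lebesgue. G s (g s))" if t: "t \<in> {0..T}" for t
    using R.mild_solution_pulled_back[OF G z t] by (simp_all add: g_def)
  have reflect: "set_integrable lebesgue {0..T} (\<lambda>s. k (T - s))"
    "(LINT s:{0..T}|lebesgue. k (T - s)) = (LINT s:{0..T}|lebesgue. k s)"
    if "set_integrable lebesgue {0..T} k" for k :: "real \<Rightarrow> 'c::{banach,second_countable_topology}"
    using set_integral_reflect[OF that, of T] by simp_all
  have int: "set_integrable lebesgue {0..T} (\<lambda>s. G s (g s))" by (rule pb(1)[of 0]) (use T in auto)
  have z_eq: "G (- (T - t)) (z t) = G (- T) z0 + (LINT s:{0..t}|lebesgue. G (- (T - s)) (g s))" if t: "t \<in> {0..T}" for t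
  proof -
    have it: "set_integrable lebesgue {0..t} (\<lambda>s. G s (g s))"
      by (rule set_integrable_subset[OF int]) (use t in auto)
    have "G (- (T - t)) (z t) = G (- T) (G t (z t))" by (simp add: add_apply)
    also have "\<dots> = G (- T) z0 + G (- T) (LINT s:{0..t}|lebesgue. G s (g s))"
      using pb(2)[of t] t by simp
    also have "G (- T) (LINT s:{0..t}|lebesgue. G s (g s)) = (LINT s:{0..t}|lebesgue. G (- T) (G s (g s)))"
      by (rule set_integrable_bounded_linear(2)[OF linear it, symmetric])
    finally show ?thesis by (simp add: add_apply)
  qed
  have int': "set_integrable lebesgue {0..T} (\<lambda>s. G (- (T - s)) (g s))"
    using set_integrable_bounded_linear(1)[OF linear[of "- T"] int] by (simp add: add_apply)
  have loadr: "continuous_on {0..T} (\<lambda>t. pulled_load f (T - t))"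
    by (rule continuous_on_compose2[OF continuous_on_pulled_load]) (auto intro!: continuous_intros)
  have "continuous_on {0..T} (\<lambda>t. G (- T) z0 + (LINT s:{0..t}|lebesgue. G (- (T - s)) (g s)) - pulled_load f (T - t) - x)"
    by (intro continuous_intros continuous_on_indefinite_integral[OF int'] loadr)
  then have e_cont: "continuous_on {0..T} e"
    by (rule continuous_on_eq) (simp only: e_def z_eq)
  have gram_e: "set_integrable lebesgue {0..T} (\<lambda>s. gram (T - s) (e s))"
    by (intro set_integrable_continuous_Icc continuous_on_gram e_cont continuous_intros)
  have e0: "e 0 = G (- T) z0 - pulled_load f T - x"
    using z_eq[of 0] T by (simp add: e_def set_integral_singleton)
  have eT: "e T = z T - x" by (simp add: e_def pulled_load_0 zero)
  have e_eq: "e t = e 0 + \<kappa> *\<^sub>R (LINT s:{0..t}|lebesgue. residual f y x (T - s) - gram (T - s) (e s))"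
    if t: "t \<in> {0..T}" for t
  proof -
    have sub: "set_integrable lebesgue {0..t} k" if "set_integrable lebesgue {0..T} k" for k :: "real \<Rightarrow> 'a"
      by (rule set_integrable_subset[OF that]) (use t in auto)
    have load_t: "(LINT s:{0..t}|lebesgue. G (- (T - s)) (f (T - s))) = pulled_load f T - pulled_load f (T - t)"
    proof -
      have "set_integrable lebesgue {T - t..T} (\<lambda>s. G (- s) (f s))"
        by (rule set_integrable_subset[OF set_integrable_pulled_load]) (use t in auto)
      from set_integral_reflect(2)[OF this, of T]
      have "(LINT s:{0..t}|lebesgue. G (- (T - s)) (f (T - s))) = (LINT s:{T - t..T}|lebesgue. G (- s) (f s))"
        by simp
      then show ?thesis
        using set_integral_split_Icc[OF set_integrable_pulled_load, of "T - t"] t by (simp add: pulled_load_def)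
    qed
    have "(LINT s:{0..t}|lebesgue. G (- (T - s)) (g s))
        = (LINT s:{0..t}|lebesgue. \<kappa> *\<^sub>R (residual f y x (T - s) - gram (T - s) (e s)) - G (- (T - s)) (f (T - s)))"
    proof (rule set_lebesgue_integral_cong)
      have "G (T - s) (e s + x + pulled_load f (T - s)) = z s" for s by (simp add: e_def add_apply zero)
      then show "\<forall>s. s \<in> {0..t} \<longrightarrow> G (- (T - s)) (g s)
          = \<kappa> *\<^sub>R (residual f y x (T - s) - gram (T - s) (e s)) - G (- (T - s)) (f (T - s))"
        by (simp only: residual_diff) (simp add: g_def)
    qed simp
    also have "\<dots> = (LINT s:{0..t}|lebesgue. \<kappa> *\<^sub>R (residual f y x (T - s) - gram (T - s) (e s)))
        - (LINT s:{0..t}|lebesgue. G (- (T - s)) (f (T - s)))"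
      by (intro set_integral_diff(2) set_integrable_scaleR_right sub set_integral_diff(1) gram_e
          reflect(1)[OF set_integrable_residual] reflect(1)[OF set_integrable_pulled_load])
    finally show ?thesis using z_eq[OF t] load_t by (simp add: e0) (simp add: e_def)
  qed
  have nres: "(LINT s:{0..T}|lebesgue. norm (residual f y x (T - s))) = (LINT s:{0..T}|lebesgue. norm (residual f y x s))"
    by (rule reflect(2)[OF set_integrable_norm[OF set_integrable_residual]])
  have "norm (e T) \<le> (1 - \<kappa> * \<delta> + 3 * (gram_bound * T)\<^sup>2 * \<kappa>\<^sup>2) * norm (e 0)
      + 2 * (gram_bound * T) * (LINT s:{0..T}|lebesgue. norm (residual f y x (T - s))) * \<kappa>\<^sup>2"
  proof (rule half_cycle_estimate[OF T reflect(1)[OF set_integrable_residual] _ bounded_linear_gram gram_bound_nonneg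
          norm_gram_le reflect(1)[OF set_integrable_gram] _ gram_e e_eq \<kappa>])
    show "(LINT s:{0..T}|lebesgue. residual f y x (T - s)) = 0"
      using reflect(2)[OF set_integrable_residual] x by simp
    show "\<delta> * (norm v)\<^sup>2 \<le> v \<bullet> (LINT s:{0..T}|lebesgue. gram (T - s) v)" for v
      using gram_coercive[of v] by (simp add: reflect(2)[OF set_integrable_gram] inner_commute)
  qed
  then show ?thesis by (simp add: eT e0 nres cycle_noise_def)
qed

end

end

section \<open>Convergence of back and forth nudging\<close>

theorem theorem3p1:
  fixes D :: "'a::{real_inner,banach,second_countable_topology} set"
    and A :: "'a \<Rightarrow> 'a"
    and C :: "'a \<Rightarrow> 'b::{real_inner,banach,second_countable_topology}"
    and T \<delta> :: real
    and f \<eta> z :: "real \<Rightarrow> 'a"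
    and z0 :: 'a
    and y \<nu> :: "real \<Rightarrow> 'b"
    and \<kappa> :: "nat \<Rightarrow> real"
    and zp zm :: "nat \<Rightarrow> real \<Rightarrow> 'a"
  assumes T: "T > 0"
    and generator: "generates_contraction_semigroup D A"
    and adj_dom: "adj_domain D A = D"
    and skew: "\<And>x. x \<in> D \<Longrightarrow> A x + adj_operator D A x = 0"
    and C: "bounded_linear C"
    and \<delta>: "\<delta> > 0"
    and observability:
      "\<And>x. (LINT t:{0..T}|lebesgue. (norm (C (exp_semigroup D A t x)))\<^sup>2) \<ge> \<delta> * (norm x)\<^sup>2"
    and load: "set_integrable lebesgue {0..T} f"
    and state: "is_mild_solution D A T (\<lambda>t. f t + \<eta> t) z0 z"
    and "output": "\<And>t. t \<in> {0..T} \<Longrightarrow> y t = C (z t) + \<nu> t"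
    and y_L2: "L2_on {0..T} y"
    and gain_pos: "\<And>j. j \<ge> 1 \<Longrightarrow> \<kappa> j > 0"
    and gain_sum: "filterlim (\<lambda>n. \<Sum>j=1..n. \<kappa> j) at_top sequentially"
    and gain_sq_sum: "summable (\<lambda>j. (\<kappa> j)\<^sup>2)"
    and forward: "\<And>j. j \<ge> 1 \<Longrightarrow>
      is_mild_solution D A T
        (\<lambda>t. f t + \<kappa> j *\<^sub>R adjoint C (y t - C (zp j t))) (zp j 0) (zp j)"
    and forward_init: "\<And>j. j \<ge> 2 \<Longrightarrow> zp j 0 = zm (j - 1) T"
    and backward: "\<And>j. j \<ge> 1 \<Longrightarrow>
      is_mild_solution D (\<lambda>x. - A x) T
        (\<lambda>t. - f (T - t) + \<kappa> j *\<^sub>R adjoint C (y (T - t) - C (zm j t))) (zp j T) (zm j)"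
  shows "(\<exists>!x. is_arg_min (cost D A C T f y) (\<lambda>_. True) x) \<and>
         (\<lambda>j. zp j 0) \<longlonglongrightarrow> arg_min (cost D A C T f y) (\<lambda>_. True)"
proof -
  obtain G where group: "unitary_group G" and exp_G: "\<And>t. t \<ge> 0 \<Longrightarrow> exp_semigroup D A t = G t"
    and exp_G_back: "\<And>t. t \<ge> 0 \<Longrightarrow> exp_semigroup D (\<lambda>x. - A x) t = G (- t)"
    using Stone_group[OF generator adj_dom skew] by blast
  interpret unitary_group G by (rule group)
  interpret observed_unitary_group G C T \<delta>
  proof (intro observed_unitary_group.intro observed_unitary_group_axioms.intro
      separable_unitary_group.intro group T C \<delta>)
    fix x
    have "(LINT t:{0..T}|lebesgue. (norm (C (exp_semigroup D A t x)))\<^sup>2)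
        = (LINT t:{0..T}|lebesgue. (norm (C (G t x)))\<^sup>2)"
      by (rule set_lebesgue_integral_cong) (auto simp: exp_G)
    then show "\<delta> * (norm x)\<^sup>2 \<le> (LINT t:{0..T}|lebesgue. (norm (C (G t x)))\<^sup>2)"
      using observability[of x] by simp
  qed
  have free: "mild_sol D A f x s = G s (x + pulled_load f s)" if s: "s \<in> {0..T}" for x s
  proof -
    have "is_mild_solution D A T f x (mild_sol D A f x)" using load by (simp add: is_mild_solution_def)
    from mild_solution_pulled_back(2)[OF exp_G this s]
    have "G s (G (- s) (mild_sol D A f x s)) = G s (x + pulled_load f s)" by (simp add: pulled_load_def)
    then show ?thesis by simp
  qed
  have cost_eq: "cost D A C T f y = misfit f y"
  proof
    show "cost D A C T f y x = misfit f y x" for x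
      unfolding cost_def misfit_def[OF load y_L2]
      by (intro arg_cong2[where f = "(*)"] refl set_lebesgue_integral_cong) (auto simp: free)
  qed
  obtain X where X: "(LINT s:{0..T}|lebesgue. residual f y X s) = 0"
    by (rule normal_equation[OF load y_L2])
  have min_iff: "is_arg_min (cost D A C T f y) (\<lambda>_. True) x \<longleftrightarrow> x = X" for x
    unfolding cost_eq by (rule unique_minimizer[OF load y_L2 X])
  define q where "q = gram_bound * T"
  define K where "K = cycle_noise f y X"
  have K: "K \<ge> 0"
    unfolding K_def cycle_noise_def[OF load y_L2] set_lebesgue_integral_def
    using T gram_bound_nonneg by (intro mult_nonneg_nonneg Bochner_Integration.integral_nonneg) auto
  have "(\<lambda>j. sqrt ((\<kappa> j)\<^sup>2)) \<longlonglongrightarrow> sqrt 0"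
    by (intro tendsto_real_sqrt summable_LIMSEQ_zero gain_sq_sum)
  then have gain_0: "\<kappa> \<longlonglongrightarrow> 0" by (simp add: tendsto_rabs_zero_iff)
  \<comment> \<open>The gains are eventually small enough for both half cycle estimates, and for the quadratic term
    \<open>3 q\<^sup>2 \<kappa>\<^sup>2\<close> to consume at most half of the decay \<open>\<delta> \<kappa>\<close>.\<close>
  have small: "\<forall>\<^sub>F j in sequentially. \<kappa> j * b < c" if "c > 0" for b c
    by (rule order_tendstoD(2)[OF tendsto_mult_left_zero[OF gain_0] that])
  have "\<forall>\<^sub>F j in sequentially. norm (zp (Suc j) 0 - X)
      \<le> (1 - \<delta> / 2 * \<kappa> j) * norm (zp j 0 - X) + (2 * K) * (\<kappa> j)\<^sup>2"
    using small[OF half_gt_zero[OF zero_less_one], where b = q] small[OF zero_less_one, where b = \<delta>]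
      small[OF half_gt_zero[OF \<delta>], where b = "3 * q\<^sup>2"] eventually_ge_at_top[of 1]
  proof eventually_elim
    case (elim j)
    define \<rho> where "\<rho> = 1 - \<kappa> j * \<delta> + 3 * q\<^sup>2 * (\<kappa> j)\<^sup>2"
    define b where "b = norm (G (- T) (zp j T) - pulled_load f T - X)"
    have \<kappa>: "\<kappa> j > 0" "\<kappa> j * (gram_bound * T) \<le> 1 / 2" "\<kappa> j * \<delta> \<le> 1"
      using gain_pos elim \<delta> by (auto simp: q_def)
    have "\<kappa> j * (\<kappa> j * (3 * q\<^sup>2)) \<le> \<kappa> j * (\<delta> / 2)"
      using elim \<kappa>(1) \<delta> by (intro mult_left_mono) auto
    then have \<rho>: "\<rho> \<le> 1 - \<delta> / 2 * \<kappa> j" by (simp add: \<rho>_def power2_eq_square mult_ac)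
    moreover have "\<delta> / 2 * \<kappa> j > 0" using \<delta> \<kappa>(1) by simp
    ultimately have \<rho>1: "\<rho> \<le> 1" by linarith
    have "b \<le> \<rho> * norm (zp j 0 - X) + K * (\<kappa> j)\<^sup>2"
      using forward_half_cycle[OF load y_L2 X exp_G forward \<kappa>] elim by (simp add: b_def \<rho>_def K_def q_def)
    also have "\<dots> \<le> (1 - \<delta> / 2 * \<kappa> j) * norm (zp j 0 - X) + K * (\<kappa> j)\<^sup>2"
      using \<rho> by (intro add_mono mult_right_mono) auto
    finally have fwd: "b \<le> (1 - \<delta> / 2 * \<kappa> j) * norm (zp j 0 - X) + K * (\<kappa> j)\<^sup>2" .
    have "norm (zm j T - X) \<le> \<rho> * b + K * (\<kappa> j)\<^sup>2"
      using backward_half_cycle[OF load y_L2 X exp_G_back backward \<kappa>] elim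
      by (simp add: b_def \<rho>_def K_def q_def)
    also have "\<rho> * b \<le> b" using mult_right_mono[OF \<rho>1, of b] by (simp add: b_def)
    finally have "norm (zm j T - X) \<le> b + K * (\<kappa> j)\<^sup>2" by simp
    then show ?case using fwd forward_init[of "Suc j"] elim by simp
  qed
  then have "(\<lambda>j. norm (zp j 0 - X)) \<longlonglongrightarrow> 0"
    by (rule contraction_recursion_tendsto_0[rotated -1])
      (use gain_pos gain_sum gain_sq_sum \<delta> K in auto)
  then have "(\<lambda>j. zp j 0) \<longlonglongrightarrow> X" by (simp add: tendsto_norm_zero_iff LIM_zero_iff)
  moreover have "arg_min (cost D A C T f y) (\<lambda>_. True) = X"
    by (simp add: arg_min_def min_iff)
  ultimately show ?thesis by (simp add: min_iff)
qed

end
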